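(* Let $\mathcal{H}$ be a separable (real) Hilbert space, $T>0$, $m\in\mathbb{N}$, let $(u,b)\in W^{1,1}([0,T],\mathcal{H}^m)\times W^{1,1}([0,T],\mathbb{R}^m)$, and suppose that the moving polyhedron $C_{(u,b)}(t)=\{x\in\mathcal{H}\mid\langle u_i(t),x\rangle\le b_i(t),\ i=1,\dots,m\}$ satisfies the uniform Slater condition: for every $t\in[0,T]$ there exists $x\in\mathcal{H}$ with $\langle u_i(t),x\rangle<b_i(t)$ for all $i=1,\dots,m$. Let $x_0\in C_{(u,b)}(0)$. Then the control pair $(u,b)$ generates a unique solution $x\in W^{1,1}([0,T],\mathcal{H})$ of the sweeping process $$-\dot x(t)\in N_{C_{(u,b)}(t)}(x(t))\ \text{ for a.e. } t\in[0,T],\qquad x(0)=x_0.$$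
   Context: $W^{1,1}$ denotes the space of absolutely continuous functions (with integrable derivative) on $[0,T]$. For a convex set $C\subseteq\mathcal{H}$, $N_C(x):=\{v\in\mathcal{H}\mid\langle v,y-x\rangle\le 0\ \forall y\in C\}$ if $x\in C$, and $N_C(x):=\emptyset$ if $x\notin C$. A solution of the sweeping process is required to satisfy the (hidden) state constraint $x(t)\in C_{(u,b)}(t)$ for all $t\in[0,T]$. *)

theory Defs
  imports "HOL-Analysis.Analysis"
begin

text \<open>Bochner integrability of maps into a finite power of a separable Hilbert space requires
  the power to be second countable; the library has this only for Euclidean spaces.
  The sort \<open>metric_space\<close> keeps the arity compatible with the existing ones of \<open>vec\<close>.\<close>

instance vec :: ("{metric_space, second_countable_topology}", finite) second_countable_topology
proof
  obtain C :: "'a set set" where C: "countable C" "topological_basis C"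
    using ex_countable_basis by blast
  define B :: "('a ^ 'b) set set"
    where "B = (\<lambda>A. {y. \<forall>i. y $ i \<in> A i}) ` (\<Pi>\<^sub>E i\<in>UNIV. C)"
  have "countable B"
    unfolding B_def by (intro countable_image countable_PiE) (auto simp: C)
  moreover have "topological_basis B"
  proof (rule topological_basisI)
    fix S assume "S \<in> B"
    then obtain A where "A \<in> (\<Pi>\<^sub>E i\<in>UNIV. C)" and S: "S = {y. \<forall>i. y $ i \<in> A i}"
      unfolding B_def by (elim imageE)
    then have A: "A i \<in> C" for i
      by (auto simp: PiE_iff)
    show "open S"
      unfolding S open_vec_def
    proof
      fix x :: "'a ^ 'b" assume "x \<in> {y. \<forall>i. y $ i \<in> A i}"
      then show "\<exists>A'. (\<forall>i. open (A' i) \<and> x $ i \<in> A' i) \<and>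
          (\<forall>y. (\<forall>i. y $ i \<in> A' i) \<longrightarrow> y \<in> {y. \<forall>i. y $ i \<in> A i})"
        using topological_basis_open[OF C(2) A] by (intro exI[of _ A]) simp
    qed
  next
    fix S and x :: "'a ^ 'b" assume "open S" "x \<in> S"
    then have "\<exists>A. (\<forall>i. open (A i) \<and> x $ i \<in> A i) \<and> (\<forall>y. (\<forall>i. y $ i \<in> A i) \<longrightarrow> y \<in> S)"
      by (simp add: open_vec_def)
    then obtain A where A: "\<forall>i. open (A i) \<and> x $ i \<in> A i"
      and AS: "\<forall>y. (\<forall>i. y $ i \<in> A i) \<longrightarrow> y \<in> S"
      by (elim exE conjE)
    have "\<exists>U. U \<in> C \<and> x $ i \<in> U \<and> U \<subseteq> A i" for i
    proof -
      have "open (A i)" "x $ i \<in> A i"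
        using A by simp_all
      then obtain U where "U \<in> C" "x $ i \<in> U" "U \<subseteq> A i"
        by (rule topological_basisE[OF C(2)])
      then show ?thesis by blast
    qed
    then have "\<exists>U. \<forall>i. U i \<in> C \<and> x $ i \<in> U i \<and> U i \<subseteq> A i"
      by (intro choice allI)
    then obtain U where U: "\<forall>i. U i \<in> C \<and> x $ i \<in> U i \<and> U i \<subseteq> A i" ..
    show "\<exists>B'\<in>B. x \<in> B' \<and> B' \<subseteq> S"
    proof (rule bexI)
      show "x \<in> {y. \<forall>i. y $ i \<in> U i} \<and> {y. \<forall>i. y $ i \<in> U i} \<subseteq> S"
        using U AS by (simp add: subset_iff)
      show "{y. \<forall>i. y $ i \<in> U i} \<in> B"
        unfolding B_def by (rule image_eqI[of _ _ U]) (auto simp: U)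
    qed
  qed
  ultimately show "\<exists>B :: ('a ^ 'b) set set. countable B \<and> open = generate_topology B"
    by (intro exI[of _ B] conjI topological_basis_imp_subbasis)
qed

definition absolutely_continuous_function_on ::
    "real \<Rightarrow> real \<Rightarrow> (real \<Rightarrow> 'a::real_normed_vector) \<Rightarrow> bool" where
  "absolutely_continuous_function_on a b f \<longleftrightarrow>
    (\<forall>\<epsilon>>0. \<exists>\<delta>>0. \<forall>(n::nat) s t.
      (\<forall>i<n. a \<le> s i \<and> s i \<le> t i \<and> t i \<le> b) \<and>
      disjoint_family_on (\<lambda>i. {s i<..<t i}) {..<n} \<and>
      (\<Sum>i<n. t i - s i) < \<delta> \<longrightarrow>
      (\<Sum>i<n. norm (f (t i) - f (s i))) < \<epsilon>)"

text \<open>Elements are total functions on \<open>real\<close>; only their values on \<open>{0..T}\<close> matter.\<close>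

definition W11 ::
    "real \<Rightarrow> (real \<Rightarrow> 'a::{banach, second_countable_topology}) set" where
  "W11 T = {f. absolutely_continuous_function_on 0 T f \<and>
    (\<exists>f'. integrable (lebesgue_on {0..T}) f' \<and>
      (AE t in lebesgue_on {0..T}. (f has_vector_derivative f' t) (at t within {0..T})))}"

definition normal_cone :: "'a::real_inner set \<Rightarrow> 'a \<Rightarrow> 'a set" where
  "normal_cone C x = (if x \<in> C then {v. \<forall>y\<in>C. v \<bullet> (y - x) \<le> 0} else {})"

definition moving_polyhedron ::
    "(real \<Rightarrow> 'a::real_inner ^ 'm) \<Rightarrow> (real \<Rightarrow> real ^ 'm) \<Rightarrow> real \<Rightarrow> 'a set" where
  "moving_polyhedron u b t = {x. \<forall>i. u t $ i \<bullet> x \<le> b t $ i}"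

definition uniform_slater ::
    "real \<Rightarrow> (real \<Rightarrow> 'a::real_inner ^ 'm) \<Rightarrow> (real \<Rightarrow> real ^ 'm) \<Rightarrow> bool" where
  "uniform_slater T u b \<longleftrightarrow> (\<forall>t\<in>{0..T}. \<exists>x. \<forall>i. u t $ i \<bullet> x < b t $ i)"

definition sweeping_solution ::
    "real \<Rightarrow> (real \<Rightarrow> 'a::{real_inner, banach, second_countable_topology} set) \<Rightarrow> 'a \<Rightarrow>
      (real \<Rightarrow> 'a) \<Rightarrow> bool" where
  "sweeping_solution T C x\<^sub>0 x \<longleftrightarrow>
    x \<in> W11 T \<and>
    (AE t in lebesgue_on {0..T}.
      - vector_derivative x (at t within {0..T}) \<in> normal_cone (C t) (x t)) \<and>
    x 0 = x\<^sub>0 \<and>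
    (\<forall>t\<in>{0..T}. x t \<in> C t)"

end

theory Submission
  imports Defs
begin

text \<open>With \<open>v t = \<integral>\<^sub>0\<^sup>t (\<bar>u'\<bar> + \<bar>b'\<bar> + 1)\<close> and the time change \<open>w = v / v T\<close>, the data
  \<open>u \<circ> w\<^sup>-\<^sup>1\<close> and \<open>b \<circ> w\<^sup>-\<^sup>1\<close> are Lipschitz. Near each time a fixed Slater point makes the polyhedra locally
  Lipschitz and keeps the iterates of Moreau's catching-up scheme (project onto the set at the next grid
  point) bounded; halving the step changes the iterates by \<open>O(\<surd>h)\<close>, so they converge. The limit \<open>x\<close>
  satisfies \<open>\<bar>x t - c\<bar>\<^sup>2 \<le> \<bar>x s - c\<bar>\<^sup>2 + O((t - s)\<^sup>2)\<close> for \<open>s \<le> t\<close> and \<open>c \<in> C s\<close>, hence minus any right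
  derivative of \<open>x\<close> lies in the normal cone, and local solutions can be glued. A Lipschitz curve in a
  Hilbert space is differentiable almost everywhere because its dyadic difference quotients are an
  \<open>L\<^sup>2\<close>-bounded martingale, whose limit is a density to which Lebesgue's differentiation theorem applies.
  Undoing the time change gives the solution. Uniqueness holds since \<open>\<bar>x - y\<bar>\<^sup>2\<close> is absolutely continuous
  with nonpositive derivative almost everywhere.\<close>

subsection \<open>Projections and the catching-up scheme\<close>

text \<open>Two obstacles shape the proof. The polyhedra vary in a Lipschitz way only on bounded
  sets and only while a single point stays strictly feasible; the uniform Slater condition may
  supply a different point at every time, so existence is local. And balls of the state space need
  not be compact, so neither a limit of the scheme nor a derivative of that limit can be extracted
  by compactness. Both come from Cauchy estimates: the former from the variational inequality of
  projections, the latter from orthogonality.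

  The error in the evolution inequality is quadratic because \<open>c\<close> drifts out of the
  later sets by O(t - s) only, while the scheme itself travels O(t - s). Hence it vanishes from
  every right difference quotient.

  The summand 1 in v forces a slope of at least 1, so the inverse of w is Lipschitz. It therefore
  carries null sets of new times to null sets of old times, without which an almost everywhere
  statement about the time-changed curve would say nothing about the original one.\<close>

lemma hilbert_projection_exists:
  fixes C :: "'a::{real_inner, banach} set"
  assumes "closed C" "convex C" "C \<noteq> {}"
  shows "\<exists>p\<in>C. \<forall>c\<in>C. (y - p) \<bullet> (c - p) \<le> 0"
proof -
  define m where "m = infdist y C"
  have m0: "m \<ge> 0" by (simp add: m_def infdist_nonneg)
  have m_le: "m \<le> norm (y - c)" if "c \<in> C" for c
    using infdist_le[OF that, of y] by (simp add: m_def dist_norm)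
  have "\<exists>c\<in>C. (norm (y - c))\<^sup>2 < m\<^sup>2 + inverse (Suc n)" for n
  proof -
    have "m < sqrt (m\<^sup>2 + inverse (Suc n))"
      by (rule real_less_rsqrt) simp
    then obtain c where "c \<in> C" "dist y c < sqrt (m\<^sup>2 + inverse (Suc n))"
      using assms(3) unfolding m_def infdist_def
      by (auto simp: cInf_less_iff)
    then show ?thesis
      by (intro bexI[of _ c])
        (metis dist_norm norm_ge_zero real_sqrt_less_iff real_sqrt_abs abs_norm_cancel)
  qed
  then obtain c where c: "\<And>n. c n \<in> C" "\<And>n. (norm (y - c n))\<^sup>2 < m\<^sup>2 + inverse (Suc n)"
    by metis
  \<comment> \<open>Midpoints of the minimizing sequence lie in \<open>C\<close>, so they are no
    closer to \<open>y\<close> than \<open>m\<close>; the parallelogram identity then forces the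
    sequence to be Cauchy.\<close>
  have par: "(norm (c i - c j))\<^sup>2 \<le> 2 * inverse (Suc i) + 2 * inverse (Suc j)" for i j
  proof -
    have "(1/2) *\<^sub>R c i + (1/2) *\<^sub>R c j \<in> C"
      using c(1) assms(2) by (intro convexD) auto
    from m_le[OF this] have "m\<^sup>2 \<le> (norm (y - ((1/2) *\<^sub>R c i + (1/2) *\<^sub>R c j)))\<^sup>2"
      using m0 by (intro power_mono) auto
    moreover have "(norm (c i - c j))\<^sup>2 + 4 * (norm (y - ((1/2) *\<^sub>R c i + (1/2) *\<^sub>R c j)))\<^sup>2
        = 2 * (norm (y - c i))\<^sup>2 + 2 * (norm (y - c j))\<^sup>2"
      by (simp add: power2_norm_eq_inner inner_diff_left inner_diff_right inner_add_left
          inner_add_right inner_commute algebra_simps)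
    ultimately show ?thesis
      using c(2)[of i] c(2)[of j] by linarith
  qed
  have "Cauchy c"
  proof (rule metric_CauchyI)
    fix e :: real assume "e > 0"
    then obtain N where N: "inverse (real (Suc N)) < e\<^sup>2 / 4"
      using reals_Archimedean[of "e\<^sup>2/4"] by auto
    show "\<exists>M. \<forall>i\<ge>M. \<forall>j\<ge>M. dist (c i) (c j) < e"
    proof (intro exI allI impI)
      fix i j assume "i \<ge> N" "j \<ge> N"
      then have "inverse (real (Suc i)) \<le> inverse (real (Suc N))" "inverse (real (Suc j)) \<le> inverse (real (Suc N))"
        by (auto simp: field_simps)
      then have "(norm (c i - c j))\<^sup>2 < e\<^sup>2"
        using par[of i j] N by linarith
      then show "dist (c i) (c j) < e"
        using \<open>e > 0\<close> by (simp add: dist_norm power2_less_imp_less)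
    qed
  qed
  then obtain p where p: "c \<longlonglongrightarrow> p"
    using Cauchy_convergent_iff convergent_def by blast
  have pC: "p \<in> C"
    using closed_sequentially[OF assms(1)] c(1) p by blast
  have "(norm (y - p))\<^sup>2 \<le> m\<^sup>2 + 0"
  proof (rule LIMSEQ_le)
    show "(\<lambda>n. (norm (y - c n))\<^sup>2) \<longlonglongrightarrow> (norm (y - p))\<^sup>2"
      by (intro tendsto_intros p)
    show "(\<lambda>n. m\<^sup>2 + inverse (Suc n)) \<longlonglongrightarrow> m\<^sup>2 + 0"
      by (intro tendsto_intros LIMSEQ_inverse_real_of_nat)
  qed (use c(2) in \<open>auto intro: less_imp_le\<close>)
  then have "norm (y - p) \<le> m"
    by (intro power2_le_imp_le[OF _ m0]) simp
  then have "dist y p \<le> dist y c" if "c \<in> C" for c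
    using m_le[OF that] by (simp add: dist_norm)
  then show ?thesis
    using any_closest_point_dot[OF assms(2,1) pC] pC by blast
qed

text \<open>Split the cross term of the expanded square at \<open>c'\<close>, to which the
  variational inequality applies. This lets \<open>c\<close> lie outside the set projected onto:
  with \<open>c\<close> from the set at an earlier time and \<open>c'\<close> its neighbour in the
  present one, the last term is the price of one step of the scheme. It is a product of two small
  lengths, which is what makes both later estimates work.\<close>

lemma projection_dist_perturbed:
  fixes y p c c' :: "'a::real_inner"
  assumes "(y - p) \<bullet> (c' - p) \<le> 0"
  shows "(norm (p - c))\<^sup>2 \<le> (norm (y - c))\<^sup>2 + 2 * norm (y - p) * norm (c - c')"
proof -
  have "(norm (y - c))\<^sup>2 = (norm (p - c))\<^sup>2 + (norm (y - p))\<^sup>2 - 2 * ((y - p) \<bullet> (c' - p)) - 2 * ((y - p) \<bullet> (c - c'))"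
    by (simp add: power2_norm_eq_inner inner_diff_left inner_diff_right inner_commute algebra_simps)
  moreover have "(y - p) \<bullet> (c - c') \<le> norm (y - p) * norm (c - c')"
    by (rule norm_cauchy_schwarz)
  ultimately show ?thesis using assms zero_le_power2[of "norm (y - p)"] by linarith
qed

lemma projection_dist_le:
  fixes y p c :: "'a::real_inner"
  assumes "(y - p) \<bullet> (c - p) \<le> 0"
  shows "norm (p - c) \<le> norm (y - c)"
  using projection_dist_perturbed[OF assms, of c] by (intro power2_le_imp_le[OF _ norm_ge_zero]) simp

lemma projection_step_le:
  fixes y p c :: "'a::real_inner"
  assumes "(y - p) \<bullet> (c - p) \<le> 0"
  shows "norm (y - p) \<le> norm (y - c)"
proof -
  have "(norm (y - c))\<^sup>2 = (norm (p - c))\<^sup>2 + (norm (y - p))\<^sup>2 - 2 * ((y - p) \<bullet> (c - p))"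
    by (simp add: power2_norm_eq_inner inner_diff_left inner_diff_right inner_commute algebra_simps)
  then have "(norm (y - p))\<^sup>2 \<le> (norm (y - c))\<^sup>2"
    using assms zero_le_power2[of "norm (p - c)"] by linarith
  then show ?thesis by (rule power2_le_imp_le) simp
qed

lemma projection_nonexpansive:
  fixes x y p q :: "'a::real_inner"
  assumes "(x - p) \<bullet> (q - p) \<le> 0" "(y - q) \<bullet> (p - q) \<le> 0"
  shows "norm (p - q) \<le> norm (x - y)"
proof -
  have "(norm (p - q))\<^sup>2 = (x - y) \<bullet> (p - q) + (x - p) \<bullet> (q - p) + (y - q) \<bullet> (p - q)"
    by (simp add: power2_norm_eq_inner inner_diff_left inner_diff_right inner_commute algebra_simps)
  also have "\<dots> \<le> norm (x - y) * norm (p - q)"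
    using assms norm_cauchy_schwarz[of "x - y" "p - q"] by linarith
  finally show ?thesis
    by (cases "p = q") (simp_all add: power2_eq_square)
qed

lemma right_derivative_nonpos:
  fixes f :: "real \<Rightarrow> real"
  assumes f: "(f has_real_derivative m) (at s within {s..})" and "d > 0"
    and le: "\<And>q. s < q \<Longrightarrow> q < s + d \<Longrightarrow> f q \<le> f s + B * (q - s)\<^sup>2"
  shows "m \<le> 0"
proof -
  have "((\<lambda>q. (f q - f s) / (q - s)) \<longlongrightarrow> m) (at s within {s..})"
    using f by (simp add: has_field_derivative_iff)
  moreover have "((\<lambda>q. B * (q - s)) \<longlongrightarrow> B * (s - s)) (at s within {s..})"
    by (intro tendsto_intros)
  moreover have "\<forall>\<^sub>F q in at s within {s..}. (f q - f s) / (q - s) \<le> B * (q - s)"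
    unfolding eventually_at
  proof (intro exI[of _ d] conjI ballI impI)
    fix q assume "q \<in> {s..}" "q \<noteq> s \<and> dist q s < d"
    then have "s < q" "q < s + d" by (auto simp: dist_real_def)
    then show "(f q - f s) / (q - s) \<le> B * (q - s)"
      using le[of q] by (simp add: field_simps power2_eq_square)
  qed (use \<open>d > 0\<close> in auto)
  moreover have "at s within {s..} \<noteq> bot"
    using trivial_limit_at_right_real[of s] by (simp add: at_within_Ici_at_right)
  ultimately show ?thesis
    using tendsto_le[of "at s within {s..}" "\<lambda>q. B * (q - s)" "B * (s - s)"] by simp
qed

text \<open>Projecting onto sets that all contain \<open>z\<close> never increases the distance to
  \<open>z\<close>, so every iterate stays in the ball of radius \<open>R\<close>. The Lipschitz
  bound is therefore demanded on that ball only. Time runs over the whole line so that no grid point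
  has to be treated as an end.\<close>

locale catching_up =
  fixes C :: "real \<Rightarrow> 'a::{real_inner, banach} set" and a K R :: real and z x0 :: 'a
  assumes closed_C: "closed (C t)" and convex_C: "convex (C t)" and z_in: "z \<in> C t"
    and lipschitz_R: "y \<in> C s \<Longrightarrow> norm y \<le> R \<Longrightarrow> \<exists>y'\<in>C t. norm (y - y') \<le> K * \<bar>t - s\<bar>"
    and R: "R = norm (x0 - z) + norm z"
    and K: "K \<ge> 0"
    and x0: "x0 \<in> C a"
begin

definition proj :: "real \<Rightarrow> 'a \<Rightarrow> 'a" where
  "proj t y = (SOME p. p \<in> C t \<and> (\<forall>c\<in>C t. (y - p) \<bullet> (c - p) \<le> 0))"

lemma proj_props: "proj t y \<in> C t \<and> (\<forall>c\<in>C t. (y - proj t y) \<bullet> (c - proj t y) \<le> 0)"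
  unfolding proj_def
proof (rule someI_ex)
  show "\<exists>p. p \<in> C t \<and> (\<forall>c\<in>C t. (y - p) \<bullet> (c - p) \<le> 0)"
    using hilbert_projection_exists[OF closed_C convex_C, of t y] z_in[of t] by blast
qed

lemmas proj_in = proj_props[THEN conjunct1]
lemmas proj_var = proj_props[THEN conjunct2, rule_format]

fun X :: "nat \<Rightarrow> nat \<Rightarrow> 'a" where
  "X n 0 = x0"
| "X n (Suc k) = proj (a + real (Suc k) / 2 ^ n) (X n k)"

lemmas X.simps(2) [simp del]

lemma X_in: "X n k \<in> C (a + real k / 2 ^ n)"
  by (cases k) (use x0 proj_in in \<open>auto simp: X.simps(2)\<close>)

lemma X_bounded: "norm (X n k) \<le> R"
proof -
  have "norm (X n k - z) \<le> norm (x0 - z)"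
  proof (induction k)
    case (Suc k)
    then show ?case
      using projection_dist_le[OF proj_var[OF z_in]] unfolding X.simps(2) by (rule order.trans[rotated])
  qed simp
  then show ?thesis
    using norm_triangle_ineq[of "X n k - z" z] by (simp add: R)
qed

lemma proj_step: 
  assumes "y \<in> C s" "norm y \<le> R"
  shows "norm (y - proj t y) \<le> K * \<bar>t - s\<bar>"
proof -
  obtain y' where "y' \<in> C t" "norm (y - y') \<le> K * \<bar>t - s\<bar>"
    using lipschitz_R[OF assms] by blast
  then show ?thesis
    using projection_step_le[OF proj_var[of y' t y]] by linarith
qed

lemma X_step: "norm (X n k - X n (Suc k)) \<le> K / 2 ^ n"
proof -
  have "\<bar>(a + real (Suc k) / 2 ^ n) - (a + real k / 2 ^ n)\<bar> = 1 / 2 ^ n"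
    by (simp add: add_divide_distrib)
  then show ?thesis
    using proj_step[OF X_in[of n k] X_bounded, of "a + real (Suc k) / 2 ^ n"] by (simp add: X.simps(2))
qed

lemma X_lipschitz:
  assumes "j \<le> k" shows "norm (X n k - X n j) \<le> K * (real (k - j) / 2 ^ n)"
  using assms
proof (induction k rule: dec_induct)
  case (step k)
  have "norm (X n (Suc k) - X n j) \<le> norm (X n k - X n (Suc k)) + norm (X n k - X n j)"
    using norm_triangle_ineq[of "X n (Suc k) - X n k" "X n k - X n j"] by (simp add: norm_minus_commute)
  also have "\<dots> \<le> K / 2 ^ n + K * (real (k - j) / 2 ^ n)"
    using step X_step by (intro add_mono) auto
  also have "\<dots> = K * (real (Suc k - j) / 2 ^ n)"
    using step by (simp add: Suc_diff_le add_divide_distrib distrib_left)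
  finally show ?case .
qed simp

text \<open>Two fine steps are compared with one coarse step. At the intermediate time the fine
  iterate is projected while the coarse one rests, at distance at most \<open>K / 2 ^ Suc n\<close>
  from the set; by \<open>projection_dist_perturbed\<close> the squared distance grows by at most
  \<open>(K / 2 ^ n)\<^sup>2 / 2\<close>. Then both are projected onto the same set, which expands
  nothing. With \<open>k\<close> of order \<open>2 ^ n\<close> the squared distance is of the order
  of the step.\<close>

lemma X_refine: "(norm (X n k - X (Suc n) (2 * k)))\<^sup>2 \<le> real k * (K / 2 ^ n)\<^sup>2 / 2"
proof (induction k)
  case (Suc k)
  define t where "t = a + real k / 2 ^ n"
  define t1 where "t1 = a + real (Suc (2 * k)) / 2 ^ Suc n"
  define t2 where "t2 = a + real (Suc k) / 2 ^ n"
  define x where "x = X n k"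
  define y where "y = X (Suc n) (2 * k)"
  define y1 where "y1 = X (Suc n) (Suc (2 * k))"
  have t2': "t2 = a + real (Suc (Suc (2 * k))) / 2 ^ Suc n"
    by (simp add: t2_def add_divide_distrib)
  have h: "\<bar>t1 - t\<bar> = 1 / 2 ^ Suc n" by (simp add: t1_def t_def add_divide_distrib)
  have yy1: "norm (y - y1) \<le> K / 2 ^ Suc n"
    unfolding y_def y1_def by (rule X_step)
  obtain c where c: "c \<in> C t1" "norm (x - c) \<le> K / 2 ^ Suc n"
    using lipschitz_R[of x t t1] X_in[of n k] X_bounded[of n k] h by (auto simp: x_def t_def)
  have y1: "y1 = proj t1 y" by (simp add: y1_def y_def t1_def X.simps(2))
  have "(norm (y1 - x))\<^sup>2 \<le> (norm (y - x))\<^sup>2 + 2 * norm (y - y1) * norm (x - c)"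
    unfolding y1 by (rule projection_dist_perturbed[OF proj_var[OF c(1)]])
  also have "2 * norm (y - y1) * norm (x - c) \<le> 2 * (K / 2 ^ Suc n) * (K / 2 ^ Suc n)"
    using yy1 c(2) K by (intro mult_mono) auto
  also have "\<dots> = (K / 2 ^ n)\<^sup>2 / 2" by (simp add: power2_eq_square)
  also have "(norm (y - x))\<^sup>2 \<le> real k * (K / 2 ^ n)\<^sup>2 / 2"
    using Suc by (simp add: x_def y_def norm_minus_commute)
  finally have 1: "(norm (y1 - x))\<^sup>2 \<le> real (Suc k) * (K / 2 ^ n)\<^sup>2 / 2"
    by (simp add: distrib_right add_divide_distrib)
  have "norm (proj t2 x - proj t2 y1) \<le> norm (x - y1)"
    by (intro projection_nonexpansive proj_var proj_in)
  then have "(norm (proj t2 x - proj t2 y1))\<^sup>2 \<le> (norm (y1 - x))\<^sup>2"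
    by (intro power_mono) (auto simp: norm_minus_commute)
  also note 1
  finally have "(norm (proj t2 x - proj t2 y1))\<^sup>2 \<le> real (Suc k) * (K / 2 ^ n)\<^sup>2 / 2" .
  moreover have "X n (Suc k) = proj t2 x" by (simp add: x_def t2_def X.simps(2))
  moreover have "X (Suc n) (2 * Suc k) = proj t2 y1" by (simp add: y1_def t2' X.simps(2))
  ultimately show ?case by (simp only:)
qed simp

definition ix :: "nat \<Rightarrow> real \<Rightarrow> nat" where "ix n t = nat \<lfloor>(t - a) * 2 ^ n\<rfloor>"

lemma ix_bounds:
  assumes "t \<ge> a"
  shows "a + real (ix n t) / 2 ^ n \<le> t" "t < a + real (ix n t) / 2 ^ n + 1 / 2 ^ n"
proof -
  have "(t - a) * 2 ^ n \<ge> 0" using assms by simp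
  then have "real (ix n t) \<le> (t - a) * 2 ^ n \<and> (t - a) * 2 ^ n < real (ix n t) + 1"
    unfolding ix_def by linarith
  then show "a + real (ix n t) / 2 ^ n \<le> t" "t < a + real (ix n t) / 2 ^ n + 1 / 2 ^ n"
    using pos_divide_le_eq[of "2 ^ n" "real (ix n t)" "t - a"]
      pos_less_divide_eq[of "2 ^ n" "t - a" "real (ix n t) + 1"] by (auto simp: add_divide_distrib)
qed

lemma ix_mono: "s \<le> t \<Longrightarrow> ix n s \<le> ix n t"
  unfolding ix_def by (intro nat_mono floor_mono) simp

lemma ix_Suc: 
  assumes "t \<ge> a"
  shows "ix (Suc n) t = 2 * ix n t \<or> ix (Suc n) t = Suc (2 * ix n t)"
proof -
  have "(t - a) * 2 ^ n \<ge> 0" using assms by simp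
  moreover have "(t - a) * 2 ^ Suc n = 2 * ((t - a) * 2 ^ n)" by simp
  ultimately show ?thesis unfolding ix_def by linarith
qed

lemma ix_diff:
  assumes "a \<le> s" "s \<le> t"
  shows "real (ix n t - ix n s) / 2 ^ n \<le> (t - s) + 1 / 2 ^ n"
proof -
  have "real (ix n t - ix n s) / 2 ^ n = real (ix n t) / 2 ^ n - real (ix n s) / 2 ^ n"
    using ix_mono[OF assms(2), of n] by (simp only: of_nat_diff diff_divide_distrib)
  then show ?thesis
    using ix_bounds(1)[of t n] ix_bounds(2)[of s n] assms by linarith
qed

text \<open>The rate is the square root of the step \<open>1 / 2 ^ n\<close>, as in
  \<open>X_refine\<close>. If \<open>ix (Suc n) t\<close> is odd, one more fine step has to be
  crossed, at the smaller cost \<open>K / 2 ^ Suc n\<close>. The bound is geometric in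
  \<open>n\<close>, hence summable.\<close>

lemma X_diff_bound:
  assumes "t \<ge> a"
  shows "norm (X (Suc n) (ix (Suc n) t) - X n (ix n t)) \<le> K * (sqrt (t - a) + 1) * (sqrt (1/2)) ^ n"
proof -
  let ?k = "ix n t"
  have pow: "(1 / 2 ^ n :: real) = (sqrt (1/2) ^ n)\<^sup>2"
  proof -
    have "(sqrt (1/2) ^ n)\<^sup>2 = ((sqrt (1/2))\<^sup>2) ^ n" by (simp only: power_mult [symmetric] mult.commute)
    then show ?thesis by (simp add: power_one_over)
  qed
  have le1: "sqrt (1/2) ^ n \<le> 1" by (intro power_le_one) auto
  have "(norm (X n ?k - X (Suc n) (2 * ?k)))\<^sup>2 \<le> real ?k * (K / 2 ^ n)\<^sup>2 / 2" by (rule X_refine)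
  also have "\<dots> \<le> real ?k * (K / 2 ^ n)\<^sup>2" by simp
  also have "\<dots> = (real ?k / 2 ^ n) * K\<^sup>2 * (1 / 2 ^ n)"
    by (simp add: power2_eq_square)
  also have "\<dots> \<le> (t - a) * K\<^sup>2 * (1 / 2 ^ n)"
    using ix_bounds(1)[OF assms, of n] by (intro mult_right_mono) auto
  also have "\<dots> = (K * sqrt (t - a) * sqrt (1/2) ^ n)\<^sup>2"
    unfolding pow using assms by (simp add: power_mult_distrib)
  finally have 1: "norm (X n ?k - X (Suc n) (2 * ?k)) \<le> K * sqrt (t - a) * sqrt (1/2) ^ n"
    by (rule power2_le_imp_le) (use K assms in auto)
  have "norm (X (Suc n) (2 * ?k) - X (Suc n) (ix (Suc n) t)) \<le> K / 2 ^ Suc n"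
    using ix_Suc[OF assms, of n] X_step[of "Suc n" "2 * ?k"] K by fastforce
  also have "\<dots> \<le> K * (1 / 2 ^ n)" using K by (simp add: field_simps)
  also have "\<dots> \<le> K * sqrt (1/2) ^ n"
    unfolding pow power2_eq_square using K le1 by (intro mult_left_mono) (auto intro: mult_left_le)
  finally have 2: "norm (X (Suc n) (2 * ?k) - X (Suc n) (ix (Suc n) t)) \<le> K * sqrt (1/2) ^ n" .
  have "norm (X (Suc n) (ix (Suc n) t) - X n ?k) \<le>
     norm (X n ?k - X (Suc n) (2 * ?k)) + norm (X (Suc n) (2 * ?k) - X (Suc n) (ix (Suc n) t))"
    using norm_triangle_ineq[of "X (Suc n) (ix (Suc n) t) - X (Suc n) (2 * ?k)" "X (Suc n) (2 * ?k) - X n ?k"]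
    by (simp add: norm_minus_commute)
  then show ?thesis using 1 2 by (simp add: algebra_simps)
qed

lemma X_convergent:
  assumes "t \<ge> a"
  shows "convergent (\<lambda>n. X n (ix n t))"
proof -
  have "summable (\<lambda>n. X (Suc n) (ix (Suc n) t) - X n (ix n t))"
  proof (rule summable_comparison_test)
    show "\<exists>N. \<forall>n\<ge>N. norm (X (Suc n) (ix (Suc n) t) - X n (ix n t)) \<le> K * (sqrt (t - a) + 1) * (sqrt (1/2)) ^ n"
      by (intro exI allI impI X_diff_bound[OF assms])
    show "summable (\<lambda>n. K * (sqrt (t - a) + 1) * (sqrt (1/2)) ^ n)"
    proof (rule summable_mult)
      have "norm (sqrt (1/2)) < 1" unfolding real_norm_def by (simp add: real_sqrt_lt_1_iff)
      then show "summable (\<lambda>n. (sqrt (1/2)) ^ n)" by (rule summable_geometric)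
    qed
  qed
  then have "convergent (\<lambda>n. \<Sum>i<n. X (Suc i) (ix (Suc i) t) - X i (ix i t))"
    by (simp add: summable_iff_convergent)
  then have "convergent (\<lambda>n. X n (ix n t) - X 0 (ix 0 t))"
    unfolding sum_lessThan_telescope[of "\<lambda>n. X n (ix n t)"] .
  from convergent_add[OF this convergent_const[of "X 0 (ix 0 t)"]] show ?thesis by simp
qed

section \<open>The limit curve and its evolution inequality\<close>

definition x :: "real \<Rightarrow> 'a" where "x t = lim (\<lambda>n. X n (ix n t))"

lemma x_lim: "t \<ge> a \<Longrightarrow> (\<lambda>n. X n (ix n t)) \<longlonglongrightarrow> x t"
  unfolding x_def using X_convergent convergent_LIMSEQ_iff by blast

lemma half_pow: "(\<lambda>n. 1 / 2 ^ n :: real) \<longlonglongrightarrow> 0"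
  using LIMSEQ_realpow_zero[of "1/2::real"] by (simp add: power_one_over)

lemma x_a: "x a = x0"
  using LIMSEQ_unique[OF x_lim[of a]] by (simp add: ix_def)

lemma x_lipschitz:
  assumes "a \<le> s" "s \<le> t" shows "norm (x t - x s) \<le> K * (t - s)"
proof (rule LIMSEQ_le)
  show "(\<lambda>n. norm (X n (ix n t) - X n (ix n s))) \<longlonglongrightarrow> norm (x t - x s)"
    using assms by (intro tendsto_intros x_lim) auto
  have "(\<lambda>n. K * ((t - s) + 1 / 2 ^ n)) \<longlonglongrightarrow> K * ((t - s) + 0)"
    by (intro tendsto_intros half_pow)
  then show "(\<lambda>n. K * ((t - s) + 1 / 2 ^ n)) \<longlonglongrightarrow> K * (t - s)" by simp
  show "\<exists>N. \<forall>n\<ge>N. norm (X n (ix n t) - X n (ix n s)) \<le> K * ((t - s) + 1 / 2 ^ n)"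
    using X_lipschitz[OF ix_mono[OF assms(2)]] ix_diff[OF assms] K
    by (meson mult_left_mono order.trans)
qed

text \<open>The iterates belong to the sets of earlier grid times, so closedness of
  \<open>C t\<close> applies only after they have been moved into \<open>C t\<close>, at a cost of
  at most \<open>K / 2 ^ n\<close>.\<close>

lemma x_in:
  assumes "a \<le> t" shows "x t \<in> C t"
proof -
  have "\<exists>y\<in>C t. norm (X n (ix n t) - y) \<le> K / 2 ^ n" for n
  proof -
    obtain y where y: "y \<in> C t" "norm (X n (ix n t) - y) \<le> K * \<bar>t - (a + real (ix n t) / 2 ^ n)\<bar>"
      using lipschitz_R[OF X_in X_bounded] by blast
    have "\<bar>t - (a + real (ix n t) / 2 ^ n)\<bar> \<le> 1 / 2 ^ n"
      using ix_bounds[OF assms, of n] by linarith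
    from mult_left_mono[OF this K] y show ?thesis by (auto intro!: bexI[of _ y])
  qed
  then obtain y where y: "\<And>n. y n \<in> C t" "\<And>n. norm (X n (ix n t) - y n) \<le> K / 2 ^ n" by metis
  have "(\<lambda>n. K * (1 / 2 ^ n)) \<longlonglongrightarrow> K * 0" by (intro tendsto_intros half_pow)
  then have "(\<lambda>n. K / 2 ^ n) \<longlonglongrightarrow> 0" by simp
  then have "(\<lambda>n. X n (ix n t) - y n) \<longlonglongrightarrow> 0"
    by (rule Lim_null_comparison[rotated]) (use y(2) in auto)
  from tendsto_diff[OF x_lim[OF assms] this] have "y \<longlonglongrightarrow> x t" by simp
  then show ?thesis using closed_sequentially[OF closed_C] y(1) by blast
qed

text \<open>A step from the \<open>n\<close>-th grid has length at most \<open>K / 2 ^ n\<close>,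
  and \<open>c\<close> is within \<open>L * ((t - s) + 1 / 2 ^ n)\<close> of the set projected onto,
  so \<open>projection_dist_perturbed\<close> charges twice the product. Summing over the steps
  between \<open>s\<close> and \<open>t\<close> multiplies this by their number. Rounding both times
  to the grid can add one step, hence the terms \<open>1 / 2 ^ n\<close>, which disappear in the
  limit.\<close>

lemma evolution_inequality:
  assumes st: "a \<le> s" "s \<le> t" and c: "\<And>q. \<exists>c'\<in>C q. norm (c - c') \<le> L * \<bar>q - s\<bar>" and L: "L \<ge> 0"
  shows "(norm (x t - c))\<^sup>2 \<le> (norm (x s - c))\<^sup>2 + 2 * K * L * (t - s)\<^sup>2"
proof (rule LIMSEQ_le)
  let ?h = "\<lambda>n. 1 / 2 ^ n :: real"
  let ?B = "\<lambda>n. 2 * K * L * ((t - s) + ?h n)"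
  show "(\<lambda>n. (norm (X n (ix n t) - c))\<^sup>2) \<longlonglongrightarrow> (norm (x t - c))\<^sup>2"
    using st by (intro tendsto_intros x_lim) auto
  have "(\<lambda>n. (norm (X n (ix n s) - c))\<^sup>2 + ?B n * ((t - s) + ?h n)) \<longlonglongrightarrow>
      (norm (x s - c))\<^sup>2 + 2 * K * L * ((t - s) + 0) * ((t - s) + 0)"
    using st by (intro tendsto_intros x_lim half_pow) auto
  then show "(\<lambda>n. (norm (X n (ix n s) - c))\<^sup>2 + ?B n * ((t - s) + ?h n)) \<longlonglongrightarrow>
      (norm (x s - c))\<^sup>2 + 2 * K * L * (t - s)\<^sup>2"
    by (simp add: power2_eq_square mult.assoc)
  have B0: "?B n \<ge> 0" for n using K L st by simp
  have "(norm (X n k - c))\<^sup>2 \<le> (norm (X n (ix n s) - c))\<^sup>2 + ?B n * (real (k - ix n s) / 2 ^ n)"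
    if "ix n s \<le> k" "k \<le> ix n t" for n k
    using that
  proof (induction k rule: dec_induct)
    case (step k)
    define q where "q = a + real (Suc k) / 2 ^ n"
    have "real (Suc k) \<le> real (ix n t)" "real (ix n s) \<le> real k" using step by linarith+
    then have "real (Suc k) / 2 ^ n \<le> real (ix n t) / 2 ^ n" "real (ix n s) / 2 ^ n \<le> real k / 2 ^ n"
      by (simp_all add: divide_right_mono)
    moreover have "real k / 2 ^ n + ?h n = real (Suc k) / 2 ^ n" by (simp add: add_divide_distrib)
    ultimately have q: "\<bar>q - s\<bar> \<le> (t - s) + ?h n"
      unfolding q_def using ix_bounds[of t n] ix_bounds[of s n] st
      by linarith
    obtain c' where c': "c' \<in> C q" "norm (c - c') \<le> L * \<bar>q - s\<bar>" using c by blast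
    have "norm (c - c') \<le> L * ((t - s) + ?h n)"
      using c'(2) mult_left_mono[OF q L] by linarith
    then have "2 * norm (X n k - X n (Suc k)) * norm (c - c') \<le> 2 * (K / 2 ^ n) * (L * ((t - s) + ?h n))"
      using X_step[of n k] K by (intro mult_mono) auto
    moreover have "(norm (X n (Suc k) - c))\<^sup>2 \<le> (norm (X n k - c))\<^sup>2 + 2 * norm (X n k - X n (Suc k)) * norm (c - c')"
      using projection_dist_perturbed[OF proj_var[OF c'(1)], of "X n k" c] by (simp add: q_def X.simps(2))
    moreover have "2 * (K / 2 ^ n) * (L * ((t - s) + ?h n)) + ?B n * (real (k - ix n s) / 2 ^ n)
        = ?B n * (real (Suc k - ix n s) / 2 ^ n)"
      using step by (simp add: Suc_diff_le add_divide_distrib distrib_left)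
    ultimately show ?case using step by linarith
  qed simp
  then show "\<exists>N. \<forall>n\<ge>N. (norm (X n (ix n t) - c))\<^sup>2 \<le> (norm (X n (ix n s) - c))\<^sup>2 + ?B n * ((t - s) + ?h n)"
    using mult_left_mono[OF ix_diff[OF st] B0] ix_mono[OF st(2)] by (meson add_left_mono order.refl order.trans)
qed

end

text \<open>The constant may depend on the ball because the Hausdorff distance is of no use here:
  tilting a half-space slightly moves its far points arbitrarily far.\<close>

definition locally_lipschitz_family :: "(real \<Rightarrow> 'a::real_normed_vector set) \<Rightarrow> bool" where
  "locally_lipschitz_family C \<longleftrightarrow>
    (\<forall>R. \<exists>K\<ge>0. \<forall>s t. \<forall>y\<in>C s. norm y \<le> R \<longrightarrow> (\<exists>y'\<in>C t. norm (y - y') \<le> K * \<bar>t - s\<bar>))"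

text \<open>The cone condition concerns right derivatives, so at a point where two solutions are
  glued only the later one matters and concatenation is immediate. It is conditional on the
  derivative existing, which separates the construction of the curve from the proof that it is
  differentiable almost everywhere.\<close>

definition lipschitz_sweeping :: "(real \<Rightarrow> 'a::real_inner set) \<Rightarrow> real \<Rightarrow> real \<Rightarrow> 'a \<Rightarrow> (real \<Rightarrow> 'a) \<Rightarrow> bool" where
  "lipschitz_sweeping C a b x0 x \<longleftrightarrow>
    (\<exists>K. K-lipschitz_on {a..b} x) \<and> x a = x0 \<and> (\<forall>t\<in>{a..b}. x t \<in> C t) \<and>
    (\<forall>t D. a \<le> t \<longrightarrow> t < b \<longrightarrow> (x has_vector_derivative D) (at t within {t..}) \<longrightarrow> - D \<in> normal_cone (C t) (x t))"

lemma catching_up_solution: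
  fixes C :: "real \<Rightarrow> 'a::{real_inner, banach} set"
  assumes "\<And>t. closed (C t)" "\<And>t. convex (C t)" "\<And>t. z \<in> C t"
    and lip: "locally_lipschitz_family C" and "x0 \<in> C a"
  shows "\<exists>x. lipschitz_sweeping C a b x0 x"
proof -
  have lip: "\<exists>K\<ge>0. \<forall>s t. \<forall>y\<in>C s. norm y \<le> R \<longrightarrow> (\<exists>y'\<in>C t. norm (y - y') \<le> K * \<bar>t - s\<bar>)" for R
    using lip unfolding locally_lipschitz_family_def by blast
  define R where "R = norm (x0 - z) + norm z"
  obtain K where K: "K \<ge> 0" "\<And>s t y. y \<in> C s \<Longrightarrow> norm y \<le> R \<Longrightarrow> \<exists>y'\<in>C t. norm (y - y') \<le> K * \<bar>t - s\<bar>"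
    using lip[of R] by blast
  interpret catching_up C a K R z x0
    using assms K by unfold_locales (auto simp: R_def)
  show ?thesis
    unfolding lipschitz_sweeping_def
  proof (intro exI[of _ x] conjI ballI allI impI)
    have *: "dist (x s) (x t) \<le> K * dist s t" if "a \<le> s" "a \<le> t" for s t
      using x_lipschitz[of s t] x_lipschitz[of t s] that
      by (cases "s \<le> t") (auto simp: dist_norm norm_minus_commute dist_real_def)
    then show "\<exists>K. K-lipschitz_on {a..b} x"
      using K(1) by (intro exI[of _ K] lipschitz_onI) auto
    show "x a = x0" by (rule x_a)
    show "x t \<in> C t" if "t \<in> {a..b}" for t using x_in that by simp
    fix t D assume t: "a \<le> t" "t < b" and D: "(x has_vector_derivative D) (at t within {t..})"
    have "- D \<bullet> (c - x t) \<le> 0" if c: "c \<in> C t" for c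
    proof -
      \<comment> \<open>The ball is now the one through the competitor \<open>c\<close>, which may
        lie farther out than the iterates; this is why the family has to be Lipschitz on every
        ball.\<close>
      obtain L where L: "L \<ge> 0" "\<And>q. \<exists>c'\<in>C q. norm (c - c') \<le> L * \<bar>q - t\<bar>"
        using lip[of "norm c"] c by blast
      have "((\<lambda>q. (x q - c) \<bullet> (x q - c)) has_derivative
          (\<lambda>h. (x t - c) \<bullet> (h *\<^sub>R D) + (h *\<^sub>R D) \<bullet> (x t - c))) (at t within {t..})"
        using D unfolding has_vector_derivative_def by (auto intro!: derivative_eq_intros)
      moreover have "(\<lambda>h. (x t - c) \<bullet> (h *\<^sub>R D) + (h *\<^sub>R D) \<bullet> (x t - c)) = (*) (2 * (D \<bullet> (x t - c)))"
        by (simp add: fun_eq_iff inner_commute)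
      ultimately have "((\<lambda>q. (norm (x q - c))\<^sup>2) has_real_derivative 2 * (D \<bullet> (x t - c))) (at t within {t..})"
        unfolding has_field_derivative_def power2_norm_eq_inner by simp
      then have "2 * (D \<bullet> (x t - c)) \<le> 0"
        by (rule right_derivative_nonpos[of _ _ _ 1 "2 * K * L"])
          (use evolution_inequality[OF t(1) _ L(2,1)] in auto)
      then show ?thesis by (simp add: inner_diff_right)
    qed
    then show "- D \<in> normal_cone (C t) (x t)"
      using x_in[OF t(1)] by (auto simp: normal_cone_def)
  qed
qed

subsection \<open>Lipschitz moving polyhedra\<close>

lemma lipschitz_sweeping_concat:
  assumes "a \<le> m" "m \<le> b"
    and x1: "lipschitz_sweeping C a m x0 x1" and x2: "lipschitz_sweeping C m b (x1 m) x2"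
  shows "lipschitz_sweeping C a b x0 (\<lambda>t. if t \<le> m then x1 t else x2 t)"
proof -
  let ?x = "\<lambda>t. if t \<le> m then x1 t else x2 t"
  from x1 obtain K1 where K1: "K1-lipschitz_on {a..m} x1"
    and 1: "x1 a = x0" "\<And>t. t \<in> {a..m} \<Longrightarrow> x1 t \<in> C t"
      "\<And>t D. a \<le> t \<Longrightarrow> t < m \<Longrightarrow> (x1 has_vector_derivative D) (at t within {t..}) \<Longrightarrow> - D \<in> normal_cone (C t) (x1 t)"
    unfolding lipschitz_sweeping_def by blast
  from x2 obtain K2 where K2: "K2-lipschitz_on {m..b} x2"
    and 2: "x2 m = x1 m" "\<And>t. t \<in> {m..b} \<Longrightarrow> x2 t \<in> C t"
      "\<And>t D. m \<le> t \<Longrightarrow> t < b \<Longrightarrow> (x2 has_vector_derivative D) (at t within {t..}) \<Longrightarrow> - D \<in> normal_cone (C t) (x2 t)"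
    unfolding lipschitz_sweeping_def by blast
  have x2_eq: "?x t = x2 t" if "t \<ge> m" for t using that 2(1) by auto
  show ?thesis
    unfolding lipschitz_sweeping_def
  proof (intro conjI ballI allI impI)
    show "\<exists>K. K-lipschitz_on {a..b} ?x"
      using lipschitz_on_concat_max[OF K1 K2] 2(1) by auto
    show "?x a = x0" using assms(1) 1(1) by simp
    show "?x t \<in> C t" if "t \<in> {a..b}" for t using that 1(2) 2(2) by auto
    fix t D assume t: "a \<le> t" "t < b" and D: "(?x has_vector_derivative D) (at t within {t..})"
    show "- D \<in> normal_cone (C t) (?x t)"
    proof (cases "t < m")
      case True
      have "(x1 has_vector_derivative D) (at t within {t..})"
        by (rule has_vector_derivative_transform_within[OF D, of "m - t"])
          (use True in \<open>auto simp: dist_real_def\<close>)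
      then show ?thesis using 1(3)[OF t(1) True] True by simp
    next
      case False
      have "(x2 has_vector_derivative D) (at t within {t..})"
        by (rule has_vector_derivative_transform_within[OF D, of 1])
          (use False 2(1) in \<open>auto simp: le_less\<close>)
      then show ?thesis using 2(3)[of t D] t False x2_eq[of t] by simp
    qed
  qed
qed

lemma moving_polyhedron_eq_INT: "moving_polyhedron u b t = (\<Inter>i. {x. u t $ i \<bullet> x \<le> b t $ i})"
  by (auto simp: moving_polyhedron_def)

lemma closed_moving_polyhedron: "closed (moving_polyhedron u b t)"
  unfolding moving_polyhedron_eq_INT by (intro closed_INT ballI closed_halfspace_le)

lemma convex_moving_polyhedron: "convex (moving_polyhedron u b t)"
  unfolding moving_polyhedron_eq_INT by (intro convex_INT ballI convex_halfspace_le)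

text \<open>Points of \<open>C s\<close> are pulled into \<open>C t\<close> by moving them towards the Slater point.\<close>

lemma moving_polyhedron_locally_lipschitz:
  fixes u :: "real \<Rightarrow> 'a::real_inner ^ 'm"
  assumes u: "\<And>s t. norm (u t - u s) \<le> L * \<bar>t - s\<bar>" and b: "\<And>s t. norm (b t - b s) \<le> L * \<bar>t - s\<bar>"
    and z: "\<And>t i. u t $ i \<bullet> z \<le> b t $ i - \<eta>" and "\<eta> > 0" "L \<ge> 0"
  shows "locally_lipschitz_family (moving_polyhedron u b)"
  unfolding locally_lipschitz_family_def
proof
  fix R :: real
  define M where "M = \<bar>R\<bar>"
  define K where "K = L * (M + 1) * (M + norm z) / \<eta>"
  show "\<exists>K\<ge>0. \<forall>s t. \<forall>y\<in>moving_polyhedron u b s. norm y \<le> R \<longrightarrow>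
      (\<exists>y'\<in>moving_polyhedron u b t. norm (y - y') \<le> K * \<bar>t - s\<bar>)"
  proof (intro exI[of _ K] conjI allI ballI impI)
    show "K \<ge> 0" using \<open>L \<ge> 0\<close> \<open>\<eta> > 0\<close> by (simp add: K_def M_def)
    fix s t y assume y: "y \<in> moving_polyhedron u b s" "norm y \<le> R"
    \<comment> \<open>This bounds the amount by which \<open>y\<close> can violate a constraint at
      time \<open>t\<close>: the change of \<open>u\<close> contributes
      \<open>L * \<bar>t - s\<bar> * M\<close> and that of \<open>b\<close> contributes
      \<open>L * \<bar>t - s\<bar>\<close>.\<close>
    define \<delta> where "\<delta> = L * (M + 1) * \<bar>t - s\<bar>"
    have \<delta>: "\<delta> \<ge> 0" using \<open>L \<ge> 0\<close> by (simp add: \<delta>_def M_def)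
    have yM: "norm y \<le> M" using y(2) by (simp add: M_def)
    have "u t $ i \<bullet> y \<le> b t $ i + \<delta>" for i
    proof -
      have "norm (u t $ i - u s $ i) \<le> L * \<bar>t - s\<bar>" "\<bar>b t $ i - b s $ i\<bar> \<le> L * \<bar>t - s\<bar>"
        using u[of t s] b[of t s] Finite_Cartesian_Product.norm_nth_le[of "u t - u s" i] Finite_Cartesian_Product.norm_nth_le[of "b t - b s" i]
        by (auto simp del: real_norm_def simp flip: real_norm_def)
      moreover from this(1) have "(u t $ i - u s $ i) \<bullet> y \<le> (L * \<bar>t - s\<bar>) * M"
        using norm_cauchy_schwarz[of "u t $ i - u s $ i" y] mult_mono[OF _ yM, of "norm (u t $ i - u s $ i)" "L * \<bar>t - s\<bar>"]
          \<open>L \<ge> 0\<close> by fastforce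
      moreover have "u s $ i \<bullet> y \<le> b s $ i" using y(1) by (simp add: moving_polyhedron_def)
      moreover have "u t $ i \<bullet> y = (u t $ i - u s $ i) \<bullet> y + u s $ i \<bullet> y"
        by (simp add: inner_diff_left)
      moreover have "\<delta> = (L * \<bar>t - s\<bar>) * M + L * \<bar>t - s\<bar>" by (simp add: \<delta>_def algebra_simps)
      ultimately show ?thesis by linarith
    qed
    note uy = this
    \<comment> \<open>The weight for which the slack \<eta> of \<open>z\<close> pays exactly for the
      violation \<delta> of \<open>y\<close>.\<close>
    define l where "l = \<delta> / (\<delta> + \<eta>)"
    have l: "0 \<le> l" "l \<le> 1" "l \<le> \<delta> / \<eta>" "(1 - l) * \<delta> = l * \<eta>"
      using \<delta> \<open>\<eta> > 0\<close> by (auto simp: l_def divide_simps algebra_simps)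
    define y' where "y' = l *\<^sub>R z + (1 - l) *\<^sub>R y"
    have "u t $ i \<bullet> y' \<le> b t $ i" for i
    proof -
      have "u t $ i \<bullet> y' = l * (u t $ i \<bullet> z) + (1 - l) * (u t $ i \<bullet> y)"
        by (simp add: y'_def inner_add_right)
      also have "\<dots> \<le> l * (b t $ i - \<eta>) + (1 - l) * (b t $ i + \<delta>)"
        using l uy z by (intro add_mono mult_left_mono) auto
      also have "\<dots> = b t $ i" using l(4) by (simp add: algebra_simps)
      finally show ?thesis .
    qed
    then have "y' \<in> moving_polyhedron u b t" by (simp add: moving_polyhedron_def)
    moreover have "norm (y - y') \<le> K * \<bar>t - s\<bar>"
    proof -
      have "y - y' = l *\<^sub>R (y - z)" by (simp add: y'_def algebra_simps)
      then have "norm (y - y') = l * norm (y - z)" using l(1) by simp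
      also have "\<dots> \<le> (\<delta> / \<eta>) * (M + norm z)"
        using l(1,3) yM norm_triangle_ineq4[of y z] by (intro mult_mono) auto
      also have "\<dots> = K * \<bar>t - s\<bar>" by (simp add: K_def \<delta>_def)
      finally show ?thesis .
    qed
    ultimately show "\<exists>y'\<in>moving_polyhedron u b t. norm (y - y') \<le> K * \<bar>t - s\<bar>" by blast
  qed
qed

text \<open>Bolzano's bisection principle reduces the claim to short intervals around each time. The
  initial point is quantified inside the induction because the second half starts wherever the first
  one ends.\<close>

lemma lipschitz_sweeping_exists:
  fixes u :: "real \<Rightarrow> 'a::{real_inner, banach} ^ 'm"
  assumes u: "\<And>s t. norm (u t - u s) \<le> L * \<bar>t - s\<bar>" and b: "\<And>s t. norm (b t - b s) \<le> L * \<bar>t - s\<bar>"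
    and slater: "\<And>t. \<exists>x. \<forall>i. u t $ i \<bullet> x < b t $ i"
    and "L \<ge> 0" "l \<le> r" and x0: "x0 \<in> moving_polyhedron u b l"
  shows "\<exists>x. lipschitz_sweeping (moving_polyhedron u b) l r x0 x"
proof -
  let ?C = "moving_polyhedron u b"
  have "\<forall>x0\<in>?C l. \<exists>x. lipschitz_sweeping ?C l r x0 x"
    using \<open>l \<le> r\<close>
  proof (induction rule: Bolzano)
    case (trans l m r)
    show ?case
    proof
      fix x0 assume "x0 \<in> ?C l"
      then obtain x1 where x1: "lipschitz_sweeping ?C l m x0 x1" using trans by blast
      then have "x1 m \<in> ?C m" using trans by (simp add: lipschitz_sweeping_def)
      then obtain x2 where "lipschitz_sweeping ?C m r (x1 m) x2" using trans by blast
      then show "\<exists>x. lipschitz_sweeping ?C l r x0 x"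
        using lipschitz_sweeping_concat[OF _ _ x1] trans by blast
    qed
  next
    case (local t0)
    obtain z where z: "\<And>i. u t0 $ i \<bullet> z < b t0 $ i" using slater by blast
    \<comment> \<open>Half of the smallest slack of \<open>z\<close> at \<open>t0\<close>; the other
      half is spent on moving away from \<open>t0\<close>.\<close>
    define \<eta> where "\<eta> = Min (range (\<lambda>i. b t0 $ i - u t0 $ i \<bullet> z)) / 2"
    have \<eta>0: "\<eta> > 0" unfolding \<eta>_def using z by (simp add: Min_gr_iff)
    have \<eta>: "u t0 $ i \<bullet> z \<le> b t0 $ i - 2 * \<eta>" for i
    proof -
      have "2 * \<eta> \<le> b t0 $ i - u t0 $ i \<bullet> z" unfolding \<eta>_def by simp
      then show ?thesis by linarith
    qed
    \<comment> \<open>Within time \<open>d\<close> the constraints at \<open>z\<close> change by at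
      most \<open>L * (norm z + 1) * d\<close>, hence by at most \<eta>. The last summand 1 keeps
      the denominator positive when \<open>L = 0\<close>.\<close>
    define d where "d = \<eta> / (L * (norm z + 1) + 1)"
    have pos: "L * (norm z + 1) + 1 > 0" using \<open>L \<ge> 0\<close> by (simp add: add_nonneg_pos)
    then have "d > 0" using \<eta>0 by (simp add: d_def)
    have near: "u t $ i \<bullet> z \<le> b t $ i - \<eta>" if "\<bar>t - t0\<bar> \<le> d" for t i
    proof -
      have "norm (u t $ i - u t0 $ i) \<le> L * \<bar>t - t0\<bar>" "\<bar>b t $ i - b t0 $ i\<bar> \<le> L * \<bar>t - t0\<bar>"
        using u[of t t0] b[of t t0] Finite_Cartesian_Product.norm_nth_le[of "u t - u t0" i] Finite_Cartesian_Product.norm_nth_le[of "b t - b t0" i]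
        by (auto simp del: real_norm_def simp flip: real_norm_def)
      moreover from this(1) have "(u t $ i - u t0 $ i) \<bullet> z \<le> (L * \<bar>t - t0\<bar>) * norm z"
        using norm_cauchy_schwarz[of "u t $ i - u t0 $ i" z] mult_right_mono[of "norm (u t $ i - u t0 $ i)" "L * \<bar>t - t0\<bar>" "norm z"]
        by force
      moreover have "u t $ i \<bullet> z = (u t $ i - u t0 $ i) \<bullet> z + u t0 $ i \<bullet> z"
        by (simp add: inner_diff_left)
      moreover have "(L * \<bar>t - t0\<bar>) * norm z + L * \<bar>t - t0\<bar> \<le> \<eta>"
      proof -
        have "(L * \<bar>t - t0\<bar>) * norm z + L * \<bar>t - t0\<bar> = (L * (norm z + 1)) * \<bar>t - t0\<bar>"
          by (simp add: algebra_simps)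
        also have "\<dots> \<le> (L * (norm z + 1) + 1) * d"
          using that \<open>L \<ge> 0\<close> by (intro mult_mono) auto
        also have "\<dots> = \<eta>" using pos by (simp add: d_def)
        finally show ?thesis .
      qed
      ultimately show ?thesis using \<eta>[of i] by linarith
    qed
    have "\<forall>x0\<in>?C l. \<exists>x. lipschitz_sweeping ?C l r x0 x" if lr: "l \<le> t0" "t0 \<le> r" "r - l < d" for l r
    proof
      fix x0 assume x0: "x0 \<in> ?C l"
      \<comment> \<open>\<open>catching_up_solution\<close> wants sets for all real times that share
        the point \<open>z\<close>. Freezing the data outside \<open>{l..r}\<close> keeps them
        Lipschitz with the same constant and keeps the clamped times within \<open>d\<close> of
        \<open>t0\<close>.\<close>
      define cl where "cl t = max l (min r t)" for t
      have cl: "\<bar>cl t - cl s\<bar> \<le> \<bar>t - s\<bar>" "\<bar>cl t - t0\<bar> \<le> d" for s t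
        using lr by (auto simp: cl_def)
      have clL: "L * \<bar>cl t - cl s\<bar> \<le> L * \<bar>t - s\<bar>" for s t using cl(1) \<open>L \<ge> 0\<close> by (rule mult_left_mono)
      have cl_id: "cl t = t" if "t \<in> {l..r}" for t using that by (simp add: cl_def)
      let ?D = "moving_polyhedron (\<lambda>t. u (cl t)) (\<lambda>t. b (cl t))"
      have D: "?D t = ?C (cl t)" for t by (simp add: moving_polyhedron_def)
      have "\<exists>x. lipschitz_sweeping ?D l r x0 x"
      proof (rule catching_up_solution)
        show "closed (?D t)" "convex (?D t)" for t
          unfolding D by (rule closed_moving_polyhedron convex_moving_polyhedron)+
        have "u (cl t) $ i \<bullet> z \<le> b (cl t) $ i" for t i
          using near[OF cl(2)[of t], of i] \<eta>0 by linarith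
        then show "z \<in> ?D t" for t by (simp add: moving_polyhedron_def)
        show "locally_lipschitz_family ?D"
          by (rule moving_polyhedron_locally_lipschitz[OF order.trans[OF u clL] order.trans[OF b clL]
                near[OF cl(2)] \<eta>0 \<open>L \<ge> 0\<close>])
        show "x0 \<in> ?D l" using x0 lr by (simp add: D cl_id)
      qed
      then obtain x where x: "lipschitz_sweeping ?D l r x0 x" ..
      have "lipschitz_sweeping ?C l r x0 x"
        using x unfolding lipschitz_sweeping_def D by (auto simp: cl_id)
      then show "\<exists>x. lipschitz_sweeping ?C l r x0 x" by blast
    qed
    then show ?case using \<open>d > 0\<close> by blast
  qed
  then show ?thesis using x0 by blast
qed

subsection \<open>Lebesgue's differentiation theorem on the line\<close>

lemma set_integrable_lebesgue_of_integrable: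
  fixes g :: "real \<Rightarrow> 'b::{banach, second_countable_topology}"
  assumes "integrable lebesgue g" "A \<in> sets lebesgue"
  shows "set_integrable lebesgue A g"
  using integrable_mult_indicator[OF assms(2,1)] by (simp add: set_integrable_def)

text \<open>Cut \<open>g\<close> at a height \<open>n\<close>. By dominated convergence the part
  above the cut has integral below \<open>\<epsilon> / 2\<close> for some \<open>n\<close>, and the
  part below it contributes at most \<open>n\<close> times the measure of the set.\<close>

lemma integral_uniformly_small:
  fixes g :: "'a \<Rightarrow> real"
  assumes g: "integrable M g" and pos: "\<And>x. g x \<ge> 0" and "\<epsilon> > 0"
  shows "\<exists>\<delta>>0. \<forall>A\<in>sets M. emeasure M A < ennreal \<delta> \<longrightarrow> (LINT x:A|M. g x) < \<epsilon>"
proof -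
  note [measurable] = borel_measurable_integrable[OF g]
  have int_min: "integrable M (\<lambda>x. min (g x) (real n))" for n
    by (rule Bochner_Integration.integrable_bound[OF g]) (use pos in auto)
  have "(\<lambda>n. \<integral>x. g x - min (g x) (real n) \<partial>M) \<longlonglongrightarrow> (\<integral>x. 0 \<partial>M)"
  proof (rule integral_dominated_convergence[OF _ _ g])
    show "AE x in M. (\<lambda>n. g x - min (g x) (real n)) \<longlonglongrightarrow> 0"
    proof (intro AE_I2 tendsto_eventually)
      fix x
      obtain N where "g x \<le> real N" using real_arch_simple by blast
      then show "\<forall>\<^sub>F n in sequentially. g x - min (g x) (real n) = 0"
        by (intro eventually_sequentiallyI[of N]) auto
    qed
    show "AE x in M. norm (g x - min (g x) (real n)) \<le> g x" for n
      using pos by (intro AE_I2) (auto simp: min_def)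
  qed auto
  then have "(\<lambda>n. \<integral>x. g x - min (g x) (real n) \<partial>M) \<longlonglongrightarrow> 0" by simp
  then have "\<forall>\<^sub>F n in sequentially. (\<integral>x. g x - min (g x) (real n) \<partial>M) < \<epsilon> / 2"
    using \<open>\<epsilon> > 0\<close> by (intro order_tendstoD) auto
  then obtain n where n: "(\<integral>x. g x - min (g x) (real n) \<partial>M) < \<epsilon> / 2"
    by (auto simp: eventually_sequentially)
  show ?thesis
  proof (intro exI[of _ "\<epsilon> / (2 * (real n + 1))"] conjI ballI impI)
    show "\<epsilon> / (2 * (real n + 1)) > 0" using \<open>\<epsilon> > 0\<close> by simp
    fix A assume [measurable]: "A \<in> sets M" and A: "emeasure M A < ennreal (\<epsilon> / (2 * (real n + 1)))"
    then have fin: "emeasure M A < \<infinity>" using less_trans by fastforce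
    then have mA: "measure M A < \<epsilon> / (2 * (real n + 1))"
      using A \<open>\<epsilon> > 0\<close> by (simp add: emeasure_eq_ennreal_measure ennreal_less_iff)
    have int1: "integrable M (\<lambda>x. real n * indicator A x)"
      using fin by (intro integrable_mult_right integrable_real_indicator) auto
    have "(LINT x:A|M. g x) \<le> (\<integral>x. real n * indicator A x + (g x - min (g x) (real n)) \<partial>M)"
      unfolding set_lebesgue_integral_def
    proof (rule integral_mono)
      show "integrable M (\<lambda>x. indicat_real A x *\<^sub>R g x)"
        using g by (intro integrable_mult_indicator) auto
      show "integrable M (\<lambda>x. real n * indicator A x + (g x - min (g x) (real n)))"
        using g int_min int1 by (intro Bochner_Integration.integrable_add Bochner_Integration.integrable_diff) auto
      show "indicat_real A x *\<^sub>R g x \<le> real n * indicator A x + (g x - min (g x) (real n))" for x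
        by (auto simp: indicator_def min_def)
    qed
    also have "\<dots> = real n * measure M A + (\<integral>x. g x - min (g x) (real n) \<partial>M)"
      using g int_min int1 fin by (subst Bochner_Integration.integral_add) auto
    also have "real n * measure M A \<le> (real n + 1) * (\<epsilon> / (2 * (real n + 1)))"
      using mA by (intro mult_mono) auto
    also have "\<dots> = \<epsilon> / 2" by (simp add: divide_simps add_nonneg_eq_0_iff)
    finally show "(LINT x:A|M. g x) < \<epsilon>" using n by linarith
  qed
qed

lemma emeasure_ball_real: 
  fixes t h :: real
  assumes "h \<ge> 0"
  shows "emeasure lborel (ball t h) = ennreal (2 * h)"
  using assms
  by (simp add: ball_eq_greaterThanLessThan)

text \<open>The one-sided estimate behind Lebesgue's theorem. Points of the exceptional set have arbitrarily
  small balls of large average; a Vitali family of these inside an open set only slightly larger than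
  \<open>{\<psi> < p}\<close> has small total length.\<close>

lemma negligible_large_averages:
  fixes \<psi> :: "real \<Rightarrow> real"
  assumes \<psi>: "integrable lebesgue \<psi>" and pos: "\<And>x. \<psi> x \<ge> 0" and pq: "0 \<le> p" "p < q"
  shows "negligible {t. \<psi> t < p \<and> (\<forall>d>0. \<exists>h. 0 < h \<and> h < d \<and> q * (2 * h) < (LINT x:ball t h|lebesgue. \<psi> x))}"
    (is "negligible ?E")
  unfolding negligible_outer_le
proof (intro allI impI)
  fix e :: real assume "e > 0"
  note [measurable] = borel_measurable_integrable[OF \<psi>]
  define A where "A = {t. \<psi> t < p}"
  have [measurable]: "A \<in> sets lebesgue"
    unfolding A_def using measurable_sets[OF borel_measurable_integrable[OF \<psi>], of "{..<p}"]
    by (simp add: vimage_def)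
  have "e * (q - p) > 0" using \<open>e > 0\<close> pq by simp
  then obtain \<delta> where \<delta>: "\<delta> > 0"
    "\<And>B. B \<in> sets lebesgue \<Longrightarrow> emeasure lebesgue B < ennreal \<delta> \<Longrightarrow> (LINT x:B|lebesgue. \<psi> x) < e * (q - p)"
    using integral_uniformly_small[OF \<psi> pos, of "e * (q - p)"] by blast
  obtain U where U: "open U" "A \<subseteq> U" "U - A \<in> lmeasurable" "emeasure lebesgue (U - A) < ennreal \<delta>"
    using sets_lebesgue_outer_open[OF \<open>A \<in> sets lebesgue\<close> \<delta>(1)] by blast
  have [measurable]: "ball s h \<in> sets lebesgue" for s h :: real by simp
  define K where "K = {i :: real \<times> real. 0 < snd i \<and> ball (fst i) (snd i) \<subseteq> U \<and>
     q * (2 * snd i) < (LINT x:ball (fst i) (snd i)|lebesgue. \<psi> x)}"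
  have "\<exists>i. i \<in> K \<and> t \<in> ball (fst i) (snd i) \<and> snd i < d" if t: "t \<in> ?E" and "d > 0" for t d
  proof -
    have "t \<in> U" using t U(2) by (auto simp: A_def)
    then obtain r where r: "r > 0" "ball t r \<subseteq> U" using U(1) openE by blast
    obtain h where h: "0 < h" "h < min d r" "q * (2 * h) < (LINT x:ball t h|lebesgue. \<psi> x)"
    proof -
      have "\<exists>h. 0 < h \<and> h < min d r \<and> q * (2 * h) < (LINT x:ball t h|lebesgue. \<psi> x)"
        using t \<open>d > 0\<close> r(1) by (blast intro: min_less_iff_conj[THEN iffD2, OF conjI])
      then show ?thesis using that by blast
    qed
    have "ball t h \<subseteq> U" using r(2) h(2) by (force simp: subset_iff)
    then show ?thesis using h by (intro exI[of _ "(t, h)"]) (simp add: K_def)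
  qed
  then obtain C where C: "countable C" "C \<subseteq> K"
      "pairwise (\<lambda>i j. disjnt (ball (fst i) (snd i)) (ball (fst j) (snd j))) C"
      "negligible (?E - (\<Union>i\<in>C. ball (fst i) (snd i)))"
    using Vitali_covering_theorem_balls[of ?E K fst snd] by blast
  define W where "W = (\<Union>i\<in>C. ball (fst i) (snd i))"
  have W[measurable]: "W \<in> sets lebesgue"
  proof -
    have "open W" unfolding W_def by (intro open_UN) auto
    then show ?thesis by (simp add: borel_open)
  qed
  have disj: "disjoint_family_on (\<lambda>i. ball (fst i) (snd i)) C"
    using C(3) by (auto simp: disjoint_family_on_def pairwise_def disjnt_def)
  \<comment> \<open>As a measure, the integral of \<psi> is countably additive over the disjoint
    balls, so the estimate of each ball passes to their union \<open>W\<close> at once.\<close>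
  define \<nu> where "\<nu> = density lebesgue (\<lambda>x. ennreal (\<psi> x))"
  have \<nu>: "emeasure \<nu> B = ennreal (LINT x:B|lebesgue. \<psi> x)" if [measurable]: "B \<in> sets lebesgue" for B
  proof -
    have "emeasure \<nu> B = (\<integral>\<^sup>+x. ennreal (\<psi> x) * indicator B x \<partial>lebesgue)"
      unfolding \<nu>_def by (rule emeasure_density) auto
    also have "\<dots> = (\<integral>\<^sup>+x. ennreal (indicator B x *\<^sub>R \<psi> x) \<partial>lebesgue)"
      by (intro nn_integral_cong) (auto simp: indicator_def)
    also have "\<dots> = ennreal (LINT x:B|lebesgue. \<psi> x)"
      unfolding set_lebesgue_integral_def
      using pos \<psi> by (intro nn_integral_eq_integral integrable_mult_indicator) auto
    finally show ?thesis .
  qed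
  have "ennreal q * emeasure lebesgue W = (\<integral>\<^sup>+i. ennreal q * emeasure lebesgue (ball (fst i) (snd i)) \<partial>count_space C)"
    unfolding W_def by (subst emeasure_UN_countable[OF _ C(1) disj]) (auto simp: nn_integral_cmult)
  also have "\<dots> \<le> (\<integral>\<^sup>+i. emeasure \<nu> (ball (fst i) (snd i)) \<partial>count_space C)"
  proof (rule nn_integral_mono)
    fix i assume "i \<in> space (count_space C)"
    then have "i \<in> K" using C(2) by auto
    then show "ennreal q * emeasure lebesgue (ball (fst i) (snd i)) \<le> emeasure \<nu> (ball (fst i) (snd i))"
      using pq unfolding K_def
      by (simp add: \<nu> emeasure_ball_real ennreal_mult[symmetric] ennreal_leI)
  qed
  also have "\<dots> = emeasure \<nu> W"
    unfolding W_def by (subst emeasure_UN_countable[OF _ C(1) disj]) (auto simp: \<nu>_def)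
  finally have le: "ennreal q * emeasure lebesgue W \<le> ennreal (LINT x:W|lebesgue. \<psi> x)"
    by (simp add: \<nu>)
  have "emeasure lebesgue W \<noteq> \<infinity>"
  proof
    assume "emeasure lebesgue W = \<infinity>"
    then have "ennreal q * emeasure lebesgue W = \<infinity>" using pq by (simp add: ennreal_mult_top)
    then show False using le by (simp add: top_unique)
  qed
  then have W_fin: "W \<in> lmeasurable" by (auto simp: fmeasurable_def less_top)
  have intW: "0 \<le> (LINT x:W|lebesgue. \<psi> x)"
    unfolding set_lebesgue_integral_def using pos by (intro integral_nonneg_AE AE_I2) simp
  have le': "q * measure lebesgue W \<le> (LINT x:W|lebesgue. \<psi> x)"
    using le W_fin pq intW by (simp add: emeasure_eq_measure2 ennreal_mult[symmetric])
  \<comment> \<open>The part of \<open>W\<close> inside \<open>A\<close> carries density below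
    \<open>p\<close>, and the rest lies in \<open>U - A\<close>, where \<delta> was chosen to leave
    less than \<open>e * (q - p)\<close>. Against the lower bound
    \<open>q * measure lebesgue W\<close> this leaves at most \<open>e\<close> for the measure of
    \<open>W\<close>.\<close>
  have "W \<subseteq> U" using C(2) by (auto simp: W_def K_def)
  have "(LINT x:W|lebesgue. \<psi> x) \<le> (\<integral>x. p * indicator W x + indicator (U - A) x *\<^sub>R \<psi> x \<partial>lebesgue)"
    unfolding set_lebesgue_integral_def
  proof (rule integral_mono)
    show "integrable lebesgue (\<lambda>x. indicat_real W x *\<^sub>R \<psi> x)"
      by (intro integrable_mult_indicator \<psi> W)
    show "integrable lebesgue (\<lambda>x. p * indicat_real W x + indicator (U - A) x *\<^sub>R \<psi> x)"
      using W_fin U(3) by (intro Bochner_Integration.integrable_add integrable_mult_indicator \<psi>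
        integrable_mult_right integrable_real_indicator) (auto simp: fmeasurable_def)
    show "indicat_real W x *\<^sub>R \<psi> x \<le> p * indicat_real W x + indicator (U - A) x *\<^sub>R \<psi> x" for x
      using \<open>W \<subseteq> U\<close> pos[of x] pq by (auto simp: indicator_def A_def)
  qed
  also have "\<dots> = p * measure lebesgue W + (LINT x:U - A|lebesgue. \<psi> x)"
    unfolding set_lebesgue_integral_def
  proof (subst Bochner_Integration.integral_add)
    show "integrable lebesgue (\<lambda>x. p * indicat_real W x)"
      using W_fin by (intro integrable_mult_right integrable_real_indicator) (auto simp: fmeasurable_def)
    show "integrable lebesgue (\<lambda>x. indicat_real (U - A) x *\<^sub>R \<psi> x)"
      using U(3) by (intro integrable_mult_indicator \<psi>) auto
  qed simp
  also have "(LINT x:U - A|lebesgue. \<psi> x) < e * (q - p)"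
    using U by (intro \<delta>) auto
  finally have "(q - p) * measure lebesgue W \<le> (q - p) * e"
    using le' by (simp add: algebra_simps)
  then have "measure lebesgue W \<le> e" using pq by simp
  moreover have "negligible (?E - W)" using C(4) by (simp add: W_def)
  then obtain Z where Z: "Z = ?E - W" "negligible Z" by blast
  moreover have "measure lebesgue (W \<union> Z) = measure lebesgue W"
    using W Z(2) by (intro measure_Un_null_set) (auto simp: negligible_iff_null_sets)
  moreover have "W \<union> Z \<in> lmeasurable"
    by (rule fmeasurable.Un[OF W_fin negligible_imp_measurable[OF Z(2)]])
  ultimately show "\<exists>T. ?E \<subseteq> T \<and> T \<in> lmeasurable \<and> measure lebesgue T \<le> e"
    by (intro exI[of _ "W \<union> Z"]) auto
qed

text \<open>The scalar estimate is applied to the distances from \<open>g\<close> to the points of a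
  countable dense set, with rational thresholds, so that countably many null sets suffice. At a
  given \<open>t\<close> the value \<open>g t\<close> is then replaced by a nearby dense
  point.\<close>

lemma lebesgue_points:
  fixes g :: "real \<Rightarrow> 'b::{banach, second_countable_topology}"
  assumes g: "integrable lebesgue g"
  obtains N where "negligible N"
    "\<And>t \<epsilon>. t \<notin> N \<Longrightarrow> \<epsilon> > 0 \<Longrightarrow> \<exists>d>0. \<forall>h. 0 < h \<longrightarrow> h < d \<longrightarrow> (LINT x:ball t h|lebesgue. norm (g x - g t)) \<le> \<epsilon> * (2 * h)"
proof -
  obtain D :: "'b set" where D: "countable D" "\<And>X. open X \<Longrightarrow> X \<noteq> {} \<Longrightarrow> \<exists>d\<in>D. d \<in> X"
    by (erule countable_dense_setE)
  \<comment> \<open>The distance to a fixed \<open>q\<close> need not be integrable over the line,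
    but it is so over each ball around 0.\<close>
  define \<psi> where "\<psi> n q x = indicator (ball 0 (real n)) x *\<^sub>R norm (g x - q)" for n q x
  have fin: "ball s h \<in> lmeasurable" for s h :: real by simp
  have int_ball: "set_integrable lebesgue (ball s h) (\<lambda>x. norm (g x - q))" for s h q
    unfolding set_integrable_def
  proof -
    have "set_integrable lebesgue (ball s h) (\<lambda>x. g x - q)"
      using set_integrable_lebesgue_of_integrable[OF g, of "ball s h"] fin[of s h]
      by (intro set_integral_diff) (auto simp: set_integrable_def fmeasurable_def)
    from set_integrable_norm[OF this] show "integrable lebesgue (\<lambda>x. indicat_real (ball s h) x *\<^sub>R norm (g x - q))"
      by (simp add: set_integrable_def)
  qed
  have \<psi>_int: "integrable lebesgue (\<psi> n q)" for n q
    using int_ball[of 0 "real n" q] unfolding set_integrable_def \<psi>_def .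
  have \<psi>_pos: "\<psi> n q x \<ge> 0" for n q x by (simp add: \<psi>_def)
  define E where "E n q a b = {t. \<psi> n q t < a \<and> (\<forall>d>0. \<exists>h. 0 < h \<and> h < d \<and> b * (2 * h) < (LINT x:ball t h|lebesgue. \<psi> n q x))}"
    for n q a b
  define I where "I = (UNIV :: nat set) \<times> D \<times> {(a, b). a \<in> \<rat> \<and> b \<in> \<rat> \<and> 0 \<le> a \<and> a < (b::real)}"
  define N where "N = (\<Union>(n, q, a, b)\<in>I. E n q a b)"
  have "countable {(a, b). a \<in> \<rat> \<and> b \<in> \<rat> \<and> 0 \<le> a \<and> a < (b::real)}"
    by (rule countable_subset[of _ "\<rat> \<times> \<rat>"]) (auto simp: countable_rat)
  then have "countable I" unfolding I_def by (intro countable_SIGMA D) auto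
  then have "negligible N"
    unfolding N_def
    by (intro negligible_countable_Union countable_image)
      (auto simp: I_def E_def intro!: negligible_large_averages \<psi>_int \<psi>_pos)
  moreover have "\<exists>d>0. \<forall>h. 0 < h \<longrightarrow> h < d \<longrightarrow> (LINT x:ball t h|lebesgue. norm (g x - g t)) \<le> \<epsilon> * (2 * h)"
    if t: "t \<notin> N" and "\<epsilon> > 0" for t \<epsilon>
  proof -
    obtain q where q: "q \<in> D" "norm (g t - q) < \<epsilon> / 4"
      using D(2)[of "ball (g t) (\<epsilon> / 4)"] \<open>\<epsilon> > 0\<close> by (auto simp: dist_norm)
    \<comment> \<open>Since \<open>t\<close> is not exceptional, \<psi> below \<open>a\<close> at
      \<open>t\<close> gives averages at most \<open>b\<close> over small balls. With
      \<open>b < \<epsilon> / 2\<close> and \<open>g t\<close> within \<open>\<epsilon> / 4\<close>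
      of \<open>q\<close>, the total stays below \<epsilon>.\<close>
    obtain a where a: "a \<in> \<rat>" "norm (g t - q) < a" "a < \<epsilon> / 4" using Rats_dense_in_real[OF q(2)] by blast
    obtain b where b: "b \<in> \<rat>" "a < b" "b < \<epsilon> / 2"
      using Rats_dense_in_real[of a "\<epsilon> / 2"] a(3) \<open>\<epsilon> > 0\<close> by auto
    obtain n where n: "\<bar>t\<bar> < real n" using reals_Archimedean2 by blast
    have "(n, q, a, b) \<in> I" using q a b by (auto simp: I_def intro: order.trans[OF norm_ge_zero less_imp_le])
    then have "t \<notin> E n q a b" using t by (auto simp: N_def)
    moreover have "\<psi> n q t < a" using a n by (simp add: \<psi>_def)
    ultimately obtain d where d: "d > 0"
      "\<And>h. 0 < h \<Longrightarrow> h < d \<Longrightarrow> (LINT x:ball t h|lebesgue. \<psi> n q x) \<le> b * (2 * h)"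
      unfolding E_def by (blast intro: leI)
    show ?thesis
    proof (intro exI[of _ "min d (real n - \<bar>t\<bar>)"] conjI allI impI)
      show "0 < min d (real n - \<bar>t\<bar>)" using d n by simp
      fix h assume h: "0 < h" "h < min d (real n - \<bar>t\<bar>)"
      have sub: "ball t h \<subseteq> ball 0 (real n)" using h by (auto simp: dist_real_def)
      have const: "set_integrable lebesgue (ball t h) (\<lambda>x. norm (q - g t))"
        using fin[of t h] by (simp add: set_integrable_def fmeasurable_def)
      have "(LINT x:ball t h|lebesgue. norm (g x - g t)) \<le> (LINT x:ball t h|lebesgue. norm (g x - q) + norm (q - g t))"
        using norm_triangle_ineq[of "g x - q" "q - g t" for x]
        by (intro set_integral_mono int_ball set_integral_add(1) const) auto
      also have "\<dots> = (LINT x:ball t h|lebesgue. norm (g x - q)) + (LINT x:ball t h|lebesgue. norm (q - g t))"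
        by (intro set_integral_add int_ball const)
      also have "(LINT x:ball t h|lebesgue. norm (g x - q)) = (LINT x:ball t h|lebesgue. \<psi> n q x)"
        unfolding set_lebesgue_integral_def using sub
        by (intro Bochner_Integration.integral_cong) (auto simp: \<psi>_def indicator_def)
      also have "\<dots> \<le> b * (2 * h)" using d h by auto
      also have "(LINT x:ball t h|lebesgue. norm (q - g t)) = norm (q - g t) * (2 * h)"
        using emeasure_ball_real[of h t] h fin[of t h] by (simp add: set_lebesgue_integral_def measure_def)
      also have "b * (2 * h) + norm (q - g t) * (2 * h) = (b + norm (q - g t)) * (2 * h)"
        by (simp add: distrib_right)
      also have "\<dots> \<le> \<epsilon> * (2 * h)"
      proof (rule mult_right_mono)
        have "norm (q - g t) < \<epsilon> / 4" using q(2) by (simp add: norm_minus_commute)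
        then show "b + norm (q - g t) \<le> \<epsilon>" using b \<open>\<epsilon> > 0\<close> by linarith
      qed (use h in simp)
      finally show "(LINT x:ball t h|lebesgue. norm (g x - g t)) \<le> \<epsilon> * (2 * h)" by simp
    qed
  qed
  ultimately show ?thesis using that by blast
qed

lemma indefinite_integral_has_vector_derivative_ae:
  fixes g f :: "real \<Rightarrow> 'b::{banach, second_countable_topology}"
  assumes g: "integrable lebesgue g"
    and f: "\<And>r s. a \<le> r \<Longrightarrow> r \<le> s \<Longrightarrow> s \<le> b \<Longrightarrow> f s - f r = (LINT x:{r..s}|lebesgue. g x)"
  obtains N where "negligible N" "\<And>t. t \<in> {a<..<b} - N \<Longrightarrow> (f has_vector_derivative g t) (at t)"
proof -
  obtain N where N: "negligible N"
    "\<And>t \<epsilon>. t \<notin> N \<Longrightarrow> \<epsilon> > 0 \<Longrightarrow> \<exists>d>0. \<forall>h. 0 < h \<longrightarrow> h < d \<longrightarrow> (LINT x:ball t h|lebesgue. norm (g x - g t)) \<le> \<epsilon> * (2 * h)"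
    using lebesgue_points[OF g] by blast
  have "(f has_vector_derivative g t) (at t)" if t: "t \<in> {a<..<b} - N" for t
    unfolding has_vector_derivative_def has_derivative_at_alt
  proof (intro conjI allI impI)
    show "bounded_linear (\<lambda>x. x *\<^sub>R g t)" by (rule bounded_linear_scaleR_left)
    fix e :: real assume "e > 0"
    then obtain d where d: "d > 0" "\<And>h. 0 < h \<Longrightarrow> h < d \<Longrightarrow> (LINT x:ball t h|lebesgue. norm (g x - g t)) \<le> (e / 4) * (2 * h)"
      using N(2)[of t "e / 4"] t by auto
    define d' where "d' = min (d / 2) (min (t - a) (b - t))"
    show "\<exists>d>0. \<forall>y. norm (y - t) < d \<longrightarrow> norm (f y - f t - (y - t) *\<^sub>R g t) \<le> e * norm (y - t)"
    proof (intro exI[of _ d'] conjI allI impI)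
      show "d' > 0" using d t by (simp add: d'_def)
      fix y assume y: "norm (y - t) < d'"
      show "norm (f y - f t - (y - t) *\<^sub>R g t) \<le> e * norm (y - t)"
      proof (cases "y = t")
        case False
        \<comment> \<open>Doubling the radius puts the closed interval inside the open ball, whose
          length \<open>2 * h\<close> is then four times the distance from \<open>y\<close> to
          \<open>t\<close>; hence the \<open>e / 4\<close> above.\<close>
        define h where "h = 2 * \<bar>y - t\<bar>"
        have h: "0 < h" "h < d" using False y by (auto simp: h_def d'_def)
        define r where "r = min y t" define s where "s = max y t"
        have rs: "r \<le> s" "a \<le> r" "s \<le> b" "s - r = \<bar>y - t\<bar>" "{r..s} \<subseteq> ball t h"
        proof -
          show "{r..s} \<subseteq> ball t h"
            using False by (cases "y \<le> t") (auto simp: r_def s_def h_def dist_real_def)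
        qed (use y t in \<open>auto simp: r_def s_def d'_def abs_less_iff\<close>)
        have Icc: "{r..s} \<in> lmeasurable" by simp
        have const: "set_integrable lebesgue S (\<lambda>x. c)" if "S \<in> lmeasurable" for S :: "real set" and c :: 'b
          using that unfolding set_integrable_def fmeasurable_def
          by (intro integrable_scaleR_left integrable_real_indicator) auto
        have gi: "set_integrable lebesgue S (\<lambda>x. g x - g t)" if "S \<in> lmeasurable" for S
          using that by (intro set_integral_diff const set_integrable_lebesgue_of_integrable g) auto
        have "f s - f r - (s - r) *\<^sub>R g t = (LINT x:{r..s}|lebesgue. g x) - (LINT x:{r..s}|lebesgue. g t)"
          using f[OF rs(2,1,3)] rs(1) by (simp add: set_lebesgue_integral_def)
        also have "\<dots> = (LINT x:{r..s}|lebesgue. g x - g t)"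
          using Icc by (intro set_integral_diff(2)[symmetric] const set_integrable_lebesgue_of_integrable g) auto
        finally have "norm (f s - f r - (s - r) *\<^sub>R g t) \<le> (LINT x:{r..s}|lebesgue. norm (g x - g t))"
          using set_integral_norm_bound[OF gi[OF Icc]] by simp
        also have "\<dots> \<le> (LINT x:ball t h|lebesgue. norm (g x - g t))"
          unfolding set_lebesgue_integral_def
        proof (rule integral_mono)
          show "integrable lebesgue (\<lambda>x. indicat_real {r..s} x *\<^sub>R norm (g x - g t))"
            using set_integrable_norm[OF gi[OF Icc]] by (simp add: set_integrable_def)
          show "integrable lebesgue (\<lambda>x. indicat_real (ball t h) x *\<^sub>R norm (g x - g t))"
            using set_integrable_norm[OF gi, of "ball t h"] by (simp add: set_integrable_def)
          show "indicat_real {r..s} x *\<^sub>R norm (g x - g t) \<le> indicat_real (ball t h) x *\<^sub>R norm (g x - g t)" for x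
            using rs(5) by (auto simp: indicator_def)
        qed
        also have "\<dots> \<le> (e / 4) * (2 * h)" by (rule d(2)[OF h])
        also have "\<dots> = e * norm (y - t)" by (simp add: h_def)
        finally have "norm (f s - f r - (s - r) *\<^sub>R g t) \<le> e * norm (y - t)" .
        moreover have "norm (f y - f t - (y - t) *\<^sub>R g t) = norm (f s - f r - (s - r) *\<^sub>R g t)"
        proof (cases "t \<le> y")
          case True then show ?thesis by (simp add: r_def s_def)
        next
          case False
          then have "f y - f t - (y - t) *\<^sub>R g t = - (f s - f r - (s - r) *\<^sub>R g t)"
            by (simp add: r_def s_def algebra_simps)
          then show ?thesis by (metis norm_minus_cancel)
        qed
        ultimately show ?thesis by simp
      qed simp
    qed
  qed
  with N(1) show ?thesis using that by blast
qed

subsection \<open>Lipschitz curves in Hilbert spaces\<close>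

lemma set_integrable_bounded:
  fixes g :: "real \<Rightarrow> 'b::{banach, second_countable_topology}"
  assumes [measurable]: "g \<in> borel_measurable borel" "A \<in> sets borel"
    and "emeasure lborel A < \<infinity>" and "\<And>t. norm (g t) \<le> B"
  shows "set_integrable lborel A g"
  unfolding set_integrable_def
proof (rule integrableI_bounded_set[where A = A and B = B])
  show "AE x in lborel. x \<in> A \<longrightarrow> norm (indicat_real A x *\<^sub>R g x) \<le> B"
    using assms(4) by (intro AE_I2) (auto simp: indicator_def)
qed (use assms in auto)

locale lipschitz_curve =
  fixes f :: "real \<Rightarrow> 'a::{real_inner, banach, second_countable_topology}" and L :: real
  assumes lipschitz: "norm (f s - f t) \<le> L * \<bar>s - t\<bar>" and L_nonneg: "L \<ge> 0"
begin

text \<open>The slope of \<open>f\<close> across the dyadic interval of length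
  \<open>1 / 2 ^ n\<close> containing \<open>t\<close>, that is, what the average of a derivative
  over that interval would have to be.\<close>

definition dq :: "nat \<Rightarrow> real \<Rightarrow> 'a" where
  "dq n t = 2 ^ n *\<^sub>R (f ((of_int \<lfloor>t * 2 ^ n\<rfloor> + 1) / 2 ^ n) - f (of_int \<lfloor>t * 2 ^ n\<rfloor> / 2 ^ n))"

definition J :: "nat \<Rightarrow> int \<Rightarrow> real set" where
  "J n k = {of_int k / 2 ^ n ..< (of_int k + 1) / 2 ^ n}"

lemma dq_on_J:
  assumes "t \<in> J n k"
  shows "dq n t = 2 ^ n *\<^sub>R (f ((of_int k + 1) / 2 ^ n) - f (of_int k / 2 ^ n))"
proof -
  have "of_int k \<le> t * 2 ^ n" "t * 2 ^ n < of_int k + 1"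
    using assms by (simp_all add: J_def pos_divide_le_eq pos_less_divide_eq)
  then have "\<lfloor>t * 2 ^ n\<rfloor> = k" by (simp add: floor_unique)
  then show ?thesis by (simp add: dq_def)
qed

lemma dq_bounded: "norm (dq n t) \<le> L"
proof -
  have "norm (dq n t) \<le> 2 ^ n * (L * \<bar>(of_int \<lfloor>t * 2 ^ n\<rfloor> + 1) / 2 ^ n - of_int \<lfloor>t * 2 ^ n\<rfloor> / 2 ^ n\<bar>)"
    unfolding dq_def norm_scaleR using lipschitz by (intro mult_mono) auto
  also have "\<dots> = L" by (simp flip: diff_divide_distrib)
  finally show ?thesis .
qed

lemma f_continuous: "continuous_on UNIV f"
proof -
  have "L-lipschitz_on UNIV f"
    using lipschitz L_nonneg by (intro lipschitz_onI) (auto simp: dist_norm)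
  then show ?thesis by (rule lipschitz_on_continuous_on)
qed

lemma dq_measurable[measurable]: "dq n \<in> borel_measurable borel"
proof -
  have [measurable]: "f \<in> borel_measurable borel"
    using f_continuous by (rule borel_measurable_continuous_onI)
  show ?thesis unfolding dq_def by measurable
qed

lemma J_borel[measurable]: "J n k \<in> sets borel" by (simp add: J_def)

lemma J_emeasure: "emeasure lborel (J n k) = ennreal (1 / 2 ^ n)"
  by (simp add: J_def divide_right_mono diff_divide_distrib[symmetric])

lemma J_split: "J n k = J (Suc n) (2 * k) \<union> J (Suc n) (2 * k + 1)" "J (Suc n) (2 * k) \<inter> J (Suc n) (2 * k + 1) = {}"
proof -
  have "of_int (2 * k) / 2 ^ Suc n = (of_int k / 2 ^ n :: real)"
    "(of_int (2 * k + 1) + 1) / 2 ^ Suc n = ((of_int k + 1) / 2 ^ n :: real)"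
    "(of_int (2 * k) + 1) / 2 ^ Suc n = (of_int (2 * k + 1) / 2 ^ Suc n :: real)"
    by (simp_all add: divide_simps)
  moreover have "of_int (2 * k) / 2 ^ Suc n \<le> (of_int (2 * k + 1) / 2 ^ Suc n :: real)"
    "of_int (2 * k + 1) / 2 ^ Suc n \<le> ((of_int (2 * k + 1) + 1) / 2 ^ Suc n :: real)"
    by (intro divide_right_mono; simp)+
  ultimately show "J n k = J (Suc n) (2 * k) \<union> J (Suc n) (2 * k + 1)" "J (Suc n) (2 * k) \<inter> J (Suc n) (2 * k + 1) = {}"
    unfolding J_def by auto
qed

lemma int_J_split:
  fixes g :: "real \<Rightarrow> 'b::{banach, second_countable_topology}"
  assumes "g \<in> borel_measurable borel" "\<And>t. norm (g t) \<le> B"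
  shows "(LINT t:J n k|lborel. g t) = (LINT t:J (Suc n) (2 * k)|lborel. g t) + (LINT t:J (Suc n) (2 * k + 1)|lborel. g t)"
  unfolding J_split(1)[of n k]
  by (intro set_integral_Un J_split(2) set_integrable_bounded[OF assms(1) J_borel _ assms(2)]) (simp_all add: J_emeasure)

text \<open>The martingale property: increments over the two halves of an interval telescope, so all
  finer slopes have the same integral over it.\<close>

lemma int_dq: "(LINT t:J n k|lborel. dq (n + d) t) = f ((of_int k + 1) / 2 ^ n) - f (of_int k / 2 ^ n)"
proof (induction d arbitrary: n k)
  case 0
  have "(LINT t:J n k|lborel. dq n t) = (LINT t:J n k|lborel. 2 ^ n *\<^sub>R (f ((of_int k + 1) / 2 ^ n) - f (of_int k / 2 ^ n)))"
    by (intro set_lebesgue_integral_cong) (auto simp: dq_on_J)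
  also have "\<dots> = f ((of_int k + 1) / 2 ^ n) - f (of_int k / 2 ^ n)"
    using J_emeasure[of n k] by (simp add: set_lebesgue_integral_def measure_def del: scaleR_diff_right)
  finally show ?case by simp
next
  case (Suc d)
  have "of_int (2 * k) / 2 ^ Suc n = (of_int k / 2 ^ n :: real)"
    "(of_int (2 * k + 1) + 1) / 2 ^ Suc n = ((of_int k + 1) / 2 ^ n :: real)"
    "(of_int (2 * k) + 1) / 2 ^ Suc n = (of_int (2 * k + 1) / 2 ^ Suc n :: real)"
    by (simp_all add: divide_simps)
  note eqs = this
  have "(LINT t:J n k|lborel. dq (n + Suc d) t) =
      (LINT t:J (Suc n) (2 * k)|lborel. dq (n + Suc d) t) + (LINT t:J (Suc n) (2 * k + 1)|lborel. dq (n + Suc d) t)"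
    by (rule int_J_split[OF dq_measurable dq_bounded])
  moreover note Suc.IH[of "Suc n" "2 * k"] Suc.IH[of "Suc n" "2 * k + 1"]
  ultimately show ?case
    by (simp only: add_Suc add_Suc_right eqs) simp
qed

lemma sq_bounded: "norm ((norm (dq m t))\<^sup>2) \<le> L\<^sup>2" "norm ((norm (dq m t - dq n t))\<^sup>2) \<le> (2 * L)\<^sup>2"
proof -
  show "norm ((norm (dq m t))\<^sup>2) \<le> L\<^sup>2" using dq_bounded[of m t] by (simp add: power_mono)
  have "norm (dq m t - dq n t) \<le> 2 * L"
    using norm_triangle_ineq4[of "dq m t" "dq n t"] dq_bounded[of m t] dq_bounded[of n t] by linarith
  then have "(norm (dq m t - dq n t))\<^sup>2 \<le> (2 * L)\<^sup>2" by (intro power_mono) auto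
  then show "norm ((norm (dq m t - dq n t))\<^sup>2) \<le> (2 * L)\<^sup>2" by simp
qed

lemma J_integrable:
  fixes g :: "real \<Rightarrow> 'b::{banach, second_countable_topology}"
  assumes "g \<in> borel_measurable borel" "\<And>t. norm (g t) \<le> B"
  shows "set_integrable lborel (J n k) g"
  by (rule set_integrable_bounded[OF assms(1) J_borel _ assms(2)]) (simp add: J_emeasure)

text \<open>The difference quotients along dyadic partitions form a martingale, whose increments are
  orthogonal in \<open>L\<^sup>2\<close>.\<close>

lemma dq_orthogonal:
  assumes "n + d \<le> m"
  shows "(LINT t:J n k|lborel. (norm (dq m t - dq (n + d) t))\<^sup>2) =
    (LINT t:J n k|lborel. (norm (dq m t))\<^sup>2) - (LINT t:J n k|lborel. (norm (dq (n + d) t))\<^sup>2)"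
  using assms
proof (induction d arbitrary: n k)
  case 0
  \<comment> \<open>On \<open>J n k\<close> the coarse slope is this constant, so by
    \<open>int_dq\<close> the cross term integrates to the integral of
    \<open>(norm c)\<^sup>2\<close> and Pythagoras follows. The induction step only halves the
    interval until this case is reached.\<close>
  define c where "c = 2 ^ n *\<^sub>R (f ((of_int k + 1) / 2 ^ n) - f (of_int k / 2 ^ n))"
  have c: "dq n t = c" if "t \<in> J n k" for t using dq_on_J[OF that] by (simp add: c_def)
  have int_inner: "set_integrable lborel (J n k) (\<lambda>t. dq m t \<bullet> c)"
  proof (rule J_integrable)
    show "norm (dq m t \<bullet> c) \<le> L * norm c" for t
      using Cauchy_Schwarz_ineq2[of "dq m t" c] mult_right_mono[OF dq_bounded[of m t], of "norm c"] by simp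
  qed measurable
  have int_const: "set_integrable lborel (J n k) (\<lambda>t. (norm c)\<^sup>2)" by (intro J_integrable) auto
  have int_sq: "set_integrable lborel (J n k) (\<lambda>t. (norm (dq m t))\<^sup>2)"
    by (rule J_integrable[OF _ sq_bounded(1)]) measurable
  have "(LINT t:J n k|lborel. dq m t \<bullet> c) = (LINT t:J n k|lborel. dq m t) \<bullet> c"
    using integral_inner_left[OF J_integrable[where n = n and k = k, OF dq_measurable dq_bounded, of m, unfolded set_integrable_def], of c]
    unfolding set_lebesgue_integral_def inner_scaleR_left by simp
  also have "(LINT t:J n k|lborel. dq m t) = (1 / 2 ^ n) *\<^sub>R c"
    using int_dq[of n k "m - n"] 0 by (simp add: c_def)
  also have "(1 / 2 ^ n) *\<^sub>R c \<bullet> c = (norm c)\<^sup>2 / 2 ^ n" by (simp add: power2_norm_eq_inner)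
  also have "(norm c)\<^sup>2 / 2 ^ n = (LINT t:J n k|lborel. (norm c)\<^sup>2)"
    using J_emeasure[of n k] by (simp add: set_lebesgue_integral_def measure_def)
  finally have inner: "(LINT t:J n k|lborel. dq m t \<bullet> c) = (LINT t:J n k|lborel. (norm c)\<^sup>2)" .
  have "(LINT t:J n k|lborel. (norm (dq m t - dq n t))\<^sup>2) =
      (LINT t:J n k|lborel. ((norm (dq m t))\<^sup>2 - 2 * (dq m t \<bullet> c)) + (norm c)\<^sup>2)"
    by (intro set_lebesgue_integral_cong)
      (auto simp: c power2_norm_eq_inner inner_diff_left inner_diff_right inner_commute)
  also have "\<dots> = (LINT t:J n k|lborel. (norm (dq m t))\<^sup>2) - 2 * (LINT t:J n k|lborel. dq m t \<bullet> c)
       + (LINT t:J n k|lborel. (norm c)\<^sup>2)"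
    using int_sq int_inner int_const
    by (simp add: set_integral_add set_integral_diff set_integral_mult_right)
  also have "\<dots> = (LINT t:J n k|lborel. (norm (dq m t))\<^sup>2) - (LINT t:J n k|lborel. (norm c)\<^sup>2)"
    by (simp add: inner)
  also have "(LINT t:J n k|lborel. (norm c)\<^sup>2) = (LINT t:J n k|lborel. (norm (dq n t))\<^sup>2)"
    by (intro set_lebesgue_integral_cong) (auto simp: c)
  finally show ?case by simp
next
  case (Suc d)
  have [measurable]: "(\<lambda>t. (norm (dq m t))\<^sup>2) \<in> borel_measurable borel"
    "(\<lambda>t. (norm (dq m t - dq n t))\<^sup>2) \<in> borel_measurable borel" for m n by measurable
  show ?case
    using Suc.IH[of "Suc n" "2 * k"] Suc.IH[of "Suc n" "2 * k + 1"] Suc.prems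
      int_J_split[where g = "\<lambda>t. (norm (dq m t))\<^sup>2" and n = n and k = k, OF _ sq_bounded(1)]
      int_J_split[where g = "\<lambda>t. (norm (dq (n + Suc d) t))\<^sup>2" and n = n and k = k, OF _ sq_bounded(1)]
      int_J_split[where g = "\<lambda>t. (norm (dq m t - dq (n + Suc d) t))\<^sup>2" and n = n and k = k, OF _ sq_bounded(2)]
    by simp
qed

section \<open>Convergence of the difference quotients to a density\<close>

definition energy :: "nat \<Rightarrow> real" where "energy n = (LINT t:J 0 0|lborel. (norm (dq n t))\<^sup>2)"

lemma energy_diff: "n \<le> m \<Longrightarrow> (LINT t:J 0 0|lborel. (norm (dq m t - dq n t))\<^sup>2) = energy m - energy n"
  using dq_orthogonal[of 0 n m 0] by (simp add: energy_def)

lemma energy_mono: "incseq energy"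
proof (rule incseq_SucI)
  fix n
  have "0 \<le> (LINT t:J 0 0|lborel. (norm (dq (Suc n) t - dq n t))\<^sup>2)"
    unfolding set_lebesgue_integral_def by (intro integral_nonneg_AE AE_I2) simp
  then show "energy n \<le> energy (Suc n)" using energy_diff[of n "Suc n"] by simp
qed

lemma energy_le: "energy n \<le> L\<^sup>2"
proof -
  have "energy n \<le> (LINT t:J 0 0|lborel. L\<^sup>2)"
    unfolding energy_def using sq_bounded(1)
    by (intro set_integral_mono J_integrable[OF _ sq_bounded(1)] J_integrable[of _ "L\<^sup>2"]) auto
  then show ?thesis using J_emeasure[of 0 0] by (simp add: set_lebesgue_integral_def measure_def)
qed

text \<open>Bounded increasing energies are Cauchy, and their gaps are squared
  \<open>L\<^sup>2\<close> distances. Gaps of size \<open>(1 / 4) ^ k\<close> make the distances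
  themselves at most \<open>(1 / 2) ^ k\<close>, which is summable.\<close>

lemma fast_subsequence:
  obtains r :: "nat \<Rightarrow> nat" where "\<And>k. k \<le> r k" "\<And>k. r k \<le> r (Suc k)" "\<And>k. energy (r (Suc k)) - energy (r k) \<le> (1 / 4) ^ k"
proof -
  have "Cauchy energy"
    using incseq_convergent[OF energy_mono] energy_le by (metis LIMSEQ_imp_Cauchy)
  then have "\<exists>N. \<forall>m\<ge>N. \<forall>n\<ge>N. norm (energy m - energy n) < (1 / 4) ^ k" for k
    unfolding Cauchy_iff by simp
  then obtain N where N: "\<And>k m n. m \<ge> N k \<Longrightarrow> n \<ge> N k \<Longrightarrow> norm (energy m - energy n) < (1 / 4) ^ k"
    by metis
  \<comment> \<open>Summing all thresholds makes \<open>r\<close> monotone and at least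
    \<open>N k\<close>; adding \<open>k\<close> gives \<open>k \<le> r k\<close>, which later sends
    the error \<open>2 * L / 2 ^ r k\<close> to 0.\<close>
  define r where "r k = (\<Sum>i\<le>k. N i) + k" for k
  have "N k \<le> r k" for k unfolding r_def by (intro trans_le_add1 member_le_sum) auto
  moreover have le: "r k \<le> r (Suc k)" for k by (simp add: r_def)
  ultimately have "norm (energy (r (Suc k)) - energy (r k)) < (1 / 4) ^ k" for k
    using N[of k "r (Suc k)" "r k"] le_trans by blast
  then have "energy (r (Suc k)) - energy (r k) \<le> (1 / 4) ^ k" for k
    by (smt (verit) real_norm_def)
  then show ?thesis using le by (intro that[of r]) (auto simp: r_def)
qed

lemma int_dq_initial: "(LINT t:{0..<real k / 2 ^ n}|lborel. dq n t) = f (real k / 2 ^ n) - f 0"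
proof (induction k)
  case 0 then show ?case by (simp add: set_lebesgue_integral_def)
next
  case (Suc k)
  have "0 \<le> real k / 2 ^ n" "real k / 2 ^ n \<le> real (Suc k) / 2 ^ n"
    by (simp_all add: divide_right_mono)
  then have "{0..<real (Suc k) / 2 ^ n} = {0..<real k / 2 ^ n} \<union> J n (int k)"
    using ivl_disj_un_two(3)[of 0 "real k / 2 ^ n" "real (Suc k) / 2 ^ n"] by (simp add: J_def add.commute)
  moreover have "(LINT t:{0..<real k / 2 ^ n} \<union> J n (int k)|lborel. dq n t) =
      (LINT t:{0..<real k / 2 ^ n}|lborel. dq n t) + (LINT t:J n (int k)|lborel. dq n t)"
    by (intro set_integral_Un J_integrable[OF dq_measurable dq_bounded]
        set_integrable_bounded[OF dq_measurable _ _ dq_bounded]) (auto simp: J_def)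
  ultimately show ?case using Suc int_dq[of n "int k" 0] by (simp add: add.commute)
qed

text \<open>The integral is exact up to the last grid point before \<open>t\<close>. On the
  remaining piece, of length at most \<open>1 / 2 ^ n\<close>, the integral and the increment of
  \<open>f\<close> are each bounded by \<open>L / 2 ^ n\<close>.\<close>

lemma int_dq_approx:
  assumes "t \<ge> 0"
  shows "norm ((LINT x:{0..<t}|lborel. dq n x) - (f t - f 0)) \<le> 2 * L / 2 ^ n"
proof -
  define k where "k = nat \<lfloor>t * 2 ^ n\<rfloor>"
  have "t * 2 ^ n \<ge> 0" using assms by simp
  then have "real k \<le> t * 2 ^ n" "t * 2 ^ n < real k + 1" unfolding k_def by linarith+
  then have k: "real k / 2 ^ n \<le> t" "t < (real k + 1) / 2 ^ n"
    by (simp_all add: pos_divide_le_eq pos_less_divide_eq)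
  then have k': "t - real k / 2 ^ n \<le> 1 / 2 ^ n" by (simp add: add_divide_distrib)
  have int: "set_integrable lborel A (dq n)" if "A = {0..<real k / 2 ^ n} \<or> A = {real k / 2 ^ n..<t}" for A
    using that k by (intro set_integrable_bounded[OF dq_measurable _ _ dq_bounded]) auto
  have "0 \<le> real k / 2 ^ n" by simp
  then have "{0..<t} = {0..<real k / 2 ^ n} \<union> {real k / 2 ^ n..<t}"
    using k(1) ivl_disj_un_two(3) by metis
  then have "(LINT x:{0..<t}|lborel. dq n x) =
      (LINT x:{0..<real k / 2 ^ n}|lborel. dq n x) + (LINT x:{real k / 2 ^ n..<t}|lborel. dq n x)"
    using int by (simp add: set_integral_Un)
  then have "(LINT x:{0..<t}|lborel. dq n x) - (f t - f 0) = (LINT x:{real k / 2 ^ n..<t}|lborel. dq n x) - (f t - f (real k / 2 ^ n))"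
    by (simp add: int_dq_initial)
  also have "norm \<dots> \<le> norm (LINT x:{real k / 2 ^ n..<t}|lborel. dq n x) + norm (f t - f (real k / 2 ^ n))"
    by (rule norm_triangle_ineq4)
  also have "norm (f t - f (real k / 2 ^ n)) \<le> L * \<bar>t - real k / 2 ^ n\<bar>" by (rule lipschitz)
  also have "\<dots> \<le> L * (1 / 2 ^ n)" using k k' L_nonneg by (intro mult_left_mono) auto
  also have "norm (LINT x:{real k / 2 ^ n..<t}|lborel. dq n x) \<le> (LINT x:{real k / 2 ^ n..<t}|lborel. norm (dq n x))"
    by (intro set_integral_norm_bound int) auto
  also have "\<dots> \<le> (LINT x:{real k / 2 ^ n..<t}|lborel. L)"
  proof (rule set_integral_mono)
    show "set_integrable lborel {real k / 2 ^ n..<t} (\<lambda>x. norm (dq n x))"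
      by (rule set_integrable_norm[OF int]) simp
    show "set_integrable lborel {real k / 2 ^ n..<t} (\<lambda>x. L)"
      using k(1) by (intro set_integrable_bounded[where B = "\<bar>L\<bar>"]) auto
  qed (rule dq_bounded)
  also have "\<dots> = L * (t - real k / 2 ^ n)" using k by (simp add: set_lebesgue_integral_def)
  also have "\<dots> \<le> L * (1 / 2 ^ n)" using k' L_nonneg by (rule mult_left_mono)
  finally show ?thesis by simp
qed

text \<open>Along the fast subsequence the integrals of the increments have a finite sum, so the
  increments are absolutely summable at almost every point. The uniform bound \<open>L\<close> then
  lets dominated convergence pass the approximate representation of \<open>f\<close> to the
  limit.\<close>

lemma density_exists:
  obtains g where "g \<in> borel_measurable borel" "\<And>t. norm (g t) \<le> L"
    "\<And>t. 0 \<le> t \<Longrightarrow> t \<le> 1 \<Longrightarrow> f t - f 0 = (LINT x:{0..<t}|lborel. g x)"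
proof -
  obtain r :: "nat \<Rightarrow> nat" where r: "\<And>k. k \<le> r k" "\<And>k. r k \<le> r (Suc k)"
    "\<And>k. energy (r (Suc k)) - energy (r k) \<le> (1 / 4) ^ k"
    using fast_subsequence by blast
  define e where "e k t = norm (dq (r (Suc k)) t - dq (r k) t)" for k t
  have e_measurable[measurable]: "e k \<in> borel_measurable borel" for k unfolding e_def by measurable
  have e_bounded: "norm (e k t) \<le> 2 * L" for k t
    using norm_triangle_ineq4[of "dq (r (Suc k)) t" "dq (r k) t"] dq_bounded[of "r (Suc k)" t] dq_bounded[of "r k" t]
    by (simp add: e_def)
  have int_e: "(LINT t:J 0 0|lborel. e k t) \<le> (1 / 2) ^ k" for k
  proof -
    have sq: "set_integrable lborel (J 0 0) (\<lambda>t. (e k t)\<^sup>2)"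
      unfolding e_def by (rule J_integrable[OF _ sq_bounded(2)]) measurable
    have const: "set_integrable lborel (J 0 0) (\<lambda>t. c)" for c :: real
      by (intro J_integrable[of _ "\<bar>c\<bar>"]) auto
    \<comment> \<open>This pointwise inequality plays the part of Cauchy-Schwarz on an interval of
      length 1. The weight \<open>2 ^ k\<close> balances its two terms, which after integration are
      each at most half of \<open>(1 / 2) ^ k\<close>.\<close>
    have "e k t \<le> (2 ^ k / 2) * (e k t)\<^sup>2 + (1 / 2) ^ k / 2" for t
    proof -
      have "0 \<le> (2 ^ k * e k t - 1)\<^sup>2" by simp
      then have "2 * 2 ^ k * e k t \<le> (2 ^ k)\<^sup>2 * (e k t)\<^sup>2 + 1" by (simp add: power2_eq_square algebra_simps)
      then show ?thesis by (simp add: power_one_over power2_eq_square field_simps)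
    qed
    then have "(LINT t:J 0 0|lborel. e k t) \<le> (LINT t:J 0 0|lborel. (2 ^ k / 2) * (e k t)\<^sup>2 + (1 / 2) ^ k / 2)"
      using sq const by (intro set_integral_mono J_integrable[OF _ e_bounded] set_integral_add set_integrable_mult_right) auto
    also have "\<dots> = (2 ^ k / 2) * (LINT t:J 0 0|lborel. (e k t)\<^sup>2) + (LINT t:J 0 0|lborel. (1 / 2) ^ k / 2)"
      using sq const by (subst set_integral_add) (auto intro!: set_integrable_mult_right)
    also have "(LINT t:J 0 0|lborel. (e k t)\<^sup>2) \<le> (1 / 4) ^ k"
      unfolding e_def using energy_diff[OF r(2)] r(3) by simp
    also have "(LINT t:J 0 0|lborel. (1 / 2) ^ k / 2) = (1 / 2 :: real) ^ k / 2"
      using J_emeasure[of 0 0] by (simp add: set_lebesgue_integral_def measure_def)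
    also have "(2 ^ k / 2) * (1 / 4) ^ k + (1 / 2) ^ k / 2 = (1 / 2 :: real) ^ k"
      by (simp add: power_one_over field_simps flip: power_mult_distrib)
    finally show ?thesis by simp
  qed
  have "(\<integral>\<^sup>+t. (\<Sum>k. ennreal (indicator (J 0 0) t *\<^sub>R e k t)) \<partial>lborel) =
      (\<Sum>k. \<integral>\<^sup>+t. ennreal (indicator (J 0 0) t *\<^sub>R e k t) \<partial>lborel)"
    by (intro nn_integral_suminf) measurable
  also have "\<dots> \<le> (\<Sum>k. ennreal ((1 / 2) ^ k))"
  proof (intro suminf_le summableI)
    fix k
    have "(\<integral>\<^sup>+t. ennreal (indicator (J 0 0) t *\<^sub>R e k t) \<partial>lborel) = ennreal (LINT t:J 0 0|lborel. e k t)"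
      unfolding set_lebesgue_integral_def
      by (rule nn_integral_eq_integral) (use J_integrable[OF e_measurable e_bounded] in \<open>auto simp: set_integrable_def e_def\<close>)
    then show "(\<integral>\<^sup>+t. ennreal (indicator (J 0 0) t *\<^sub>R e k t) \<partial>lborel) \<le> ennreal ((1 / 2) ^ k)"
      using int_e by (simp add: ennreal_leI)
  qed
  also have "\<dots> = ennreal (\<Sum>k. (1 / 2) ^ k)"
    by (intro suminf_ennreal2 summable_geometric) auto
  also have "\<dots> < \<infinity>" by simp
  finally have "(\<integral>\<^sup>+t. (\<Sum>k. ennreal (indicator (J 0 0) t *\<^sub>R e k t)) \<partial>lborel) \<noteq> \<infinity>" by simp
  then have "AE t in lborel. (\<Sum>k. ennreal (indicator (J 0 0) t *\<^sub>R e k t)) \<noteq> \<infinity>"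
    by (intro nn_integral_PInf_AE) measurable
  then have conv: "AE t in lborel. t \<in> J 0 0 \<longrightarrow> convergent (\<lambda>k. dq (r k) t)"
  proof eventually_elim
    case (elim t)
    show ?case
    proof
      assume "t \<in> J 0 0"
      then have "(\<Sum>k. ennreal (e k t)) \<noteq> \<infinity>" using elim by simp
      then have "summable (\<lambda>k. e k t)" by (intro summable_suminf_not_top) (auto simp: e_def)
      then have "summable (\<lambda>k. dq (r (Suc k)) t - dq (r k) t)" unfolding e_def by (rule summable_norm_cancel)
      then have "convergent (\<lambda>n. \<Sum>k<n. dq (r (Suc k)) t - dq (r k) t)" by (simp add: summable_iff_convergent)
      then have "convergent (\<lambda>n. dq (r n) t - dq (r 0) t)"
        unfolding sum_lessThan_telescope[of "\<lambda>n. dq (r n) t"] .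
      from convergent_add[OF this convergent_const[of "dq (r 0) t"]]
      show "convergent (\<lambda>k. dq (r k) t)" by simp
    qed
  qed
  define g0 where "g0 t = lim (\<lambda>k. dq (r k) t)" for t
  have [measurable]: "g0 \<in> borel_measurable borel" unfolding g0_def by measurable
  \<comment> \<open>Where the quotients diverge, \<open>lim\<close> is an arbitrary value. The cut
    makes the bound hold everywhere and changes nothing where they converge.\<close>
  define g where "g t = (if norm (g0 t) \<le> L then g0 t else 0)" for t
  have g[measurable]: "g \<in> borel_measurable borel" unfolding g_def by measurable
  have g_bounded: "norm (g t) \<le> L" for t using L_nonneg by (simp add: g_def)
  have lim: "AE t in lborel. t \<in> J 0 0 \<longrightarrow> (\<lambda>k. dq (r k) t) \<longlonglongrightarrow> g t"
    using conv
  proof eventually_elim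
    case (elim t)
    show ?case
    proof
      assume "t \<in> J 0 0"
      then have *: "(\<lambda>k. dq (r k) t) \<longlonglongrightarrow> g0 t" using elim by (simp add: g0_def convergent_LIMSEQ_iff)
      have "norm (g0 t) \<le> L"
        by (rule LIMSEQ_le_const2[OF tendsto_norm[OF *]]) (use dq_bounded in auto)
      then show "(\<lambda>k. dq (r k) t) \<longlonglongrightarrow> g t" using * by (simp add: g_def)
    qed
  qed
  have "f t - f 0 = (LINT x:{0..<t}|lborel. g x)" if t: "0 \<le> t" "t \<le> 1" for t
  proof (rule LIMSEQ_unique)
    show "(\<lambda>k. LINT x:{0..<t}|lborel. dq (r k) x) \<longlonglongrightarrow> (LINT x:{0..<t}|lborel. g x)"
      unfolding set_lebesgue_integral_def
    proof (rule integral_dominated_convergence)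
      show "integrable lborel (\<lambda>x. indicat_real {0..<t} x *\<^sub>R L)"
        using t by simp
      show "AE x in lborel. (\<lambda>k. indicat_real {0..<t} x *\<^sub>R dq (r k) x) \<longlonglongrightarrow> indicat_real {0..<t} x *\<^sub>R g x"
        using lim
      proof eventually_elim
        case (elim x)
        then show ?case using t by (cases "x \<in> {0..<t}") (auto simp: J_def intro!: tendsto_scaleR)
      qed
      show "AE x in lborel. norm (indicat_real {0..<t} x *\<^sub>R dq (r k) x) \<le> indicat_real {0..<t} x *\<^sub>R L" for k
        using dq_bounded by (intro AE_I2) (auto simp: indicator_def)
    qed measurable
    have "(\<lambda>k. 2 * L * (1 / 2) ^ k) \<longlonglongrightarrow> 2 * L * 0"
      by (intro tendsto_intros LIMSEQ_realpow_zero) auto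
    then have "(\<lambda>k. 2 * L * (1 / 2) ^ k) \<longlonglongrightarrow> 0" by simp
    then have "(\<lambda>k. (LINT x:{0..<t}|lborel. dq (r k) x) - (f t - f 0)) \<longlonglongrightarrow> 0"
    proof (rule Lim_null_comparison[rotated], intro always_eventually allI)
      fix k
      have "norm ((LINT x:{0..<t}|lborel. dq (r k) x) - (f t - f 0)) \<le> 2 * L / 2 ^ r k"
        by (rule int_dq_approx[OF t(1)])
      also have "\<dots> \<le> 2 * L / 2 ^ k" using L_nonneg r(1)[of k] by (intro divide_left_mono power_increasing) auto
      finally show "norm ((LINT x:{0..<t}|lborel. dq (r k) x) - (f t - f 0)) \<le> 2 * L * (1 / 2) ^ k"
        by (simp add: power_one_over)
    qed
    from LIM_zero_cancel[OF this]
    show "(\<lambda>k. LINT x:{0..<t}|lborel. dq (r k) x) \<longlonglongrightarrow> f t - f 0" .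
  qed
  with g g_bounded show ?thesis using that by blast
qed

end

text \<open>\<open>g\<close> is delivered Borel measurable and bounded everywhere because it is
  later composed with the time change: a function that is merely Lebesgue measurable can lose
  measurability under composition.\<close>

lemma lipschitz_curve_ae_differentiable:
  fixes f :: "real \<Rightarrow> 'a::{real_inner, banach, second_countable_topology}"
  assumes f: "L-lipschitz_on {0..1} f"
  obtains g N where "g \<in> borel_measurable borel" "\<And>t. norm (g t) \<le> L" "negligible N"
    "\<And>t. t \<in> {0<..<1} - N \<Longrightarrow> (f has_vector_derivative g t) (at t)"
proof -
  define cl where "cl t = max 0 (min 1 t)" for t :: real
  have L: "L \<ge> 0" using f by (rule lipschitz_on_nonneg)
  interpret lipschitz_curve "\<lambda>t. f (cl t)" L
  proof
    fix s t
    have "norm (f (cl s) - f (cl t)) \<le> L * \<bar>cl s - cl t\<bar>"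
      using lipschitz_onD[OF f, of "cl s" "cl t"] by (simp add: cl_def dist_norm)
    also have "\<dots> \<le> L * \<bar>s - t\<bar>" using L by (intro mult_left_mono) (auto simp: cl_def)
    finally show "norm (f (cl s) - f (cl t)) \<le> L * \<bar>s - t\<bar>" .
  qed (rule L)
  obtain g where g[measurable]: "g \<in> borel_measurable borel" and g_bounded: "\<And>t. norm (g t) \<le> L"
    and rep: "\<And>t. 0 \<le> t \<Longrightarrow> t \<le> 1 \<Longrightarrow> f (cl t) - f (cl 0) = (LINT x:{0..<t}|lborel. g x)"
    using density_exists by blast
  define G where "G x = indicator {0..1} x *\<^sub>R g x" for x :: real
  have [measurable]: "G \<in> borel_measurable borel" unfolding G_def by measurable
  have "set_integrable lborel {0..1} g" by (rule set_integrable_bounded[OF _ _ _ g_bounded]) auto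
  then have "integrable lborel G" by (simp add: set_integrable_def G_def[abs_def])
  then have G: "integrable lebesgue G" by (simp add: integrable_completion)
  have int: "set_integrable lborel {r..<s} g" for r s
    by (rule set_integrable_bounded[OF _ _ _ g_bounded]) (cases "r \<le> s"; simp)+
  have "f s - f r = (LINT x:{r..s}|lebesgue. G x)" if rs: "0 \<le> r" "r \<le> s" "s \<le> 1" for r s
  proof -
    have "{0..<s} = {0..<r} \<union> {r..<s}" using rs by auto
    then have "(LINT x:{0..<s}|lborel. g x) = (LINT x:{0..<r}|lborel. g x) + (LINT x:{r..<s}|lborel. g x)"
      using int by (simp add: set_integral_Un)
    then have "f s - f r = (LINT x:{r..<s}|lborel. g x)"
      using rep[of s] rep[of r] rs by (simp add: cl_def algebra_simps)
    also have "\<dots> = (LINT x:{r..s}|lborel. G x)"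
      unfolding set_lebesgue_integral_def
    proof (rule integral_cong_AE)
      show "AE x in lborel. indicat_real {r..<s} x *\<^sub>R g x = indicat_real {r..s} x *\<^sub>R G x"
        using AE_lborel_singleton[of s] by eventually_elim (use rs in \<open>auto simp: G_def indicator_def\<close>)
    qed measurable
    also have "\<dots> = (LINT x:{r..s}|lebesgue. G x)"
      unfolding set_lebesgue_integral_def by (rule integral_completion[symmetric]) measurable
    finally show ?thesis .
  qed
  from indefinite_integral_has_vector_derivative_ae[OF G this]
  obtain N where N: "negligible N" "\<And>t. t \<in> {0<..<1} - N \<Longrightarrow> (f has_vector_derivative G t) (at t)"
    by blast
  then have "(f has_vector_derivative g t) (at t)" if "t \<in> {0<..<1} - N" for t
    using N(2)[OF that] that by (simp add: G_def)
  with g g_bounded N(1) show ?thesis using that by blast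
qed

subsection \<open>Absolutely continuous functions\<close>

lemma AE_lebesgue_on_imp_negligible:
  assumes "AE t in lebesgue_on {a..b::real}. P t"
  obtains N where "negligible N" "\<And>t. t \<in> {a..b} - N \<Longrightarrow> P t"
proof -
  have "AE t in lebesgue. t \<in> {a..b} \<longrightarrow> P t"
    using assms by (subst (asm) AE_restrict_space_iff) auto
  then obtain N where "N \<in> null_sets lebesgue" "{t \<in> space lebesgue. \<not> (t \<in> {a..b} \<longrightarrow> P t)} \<subseteq> N"
    by (auto simp: eventually_ae_filter)
  then show ?thesis by (intro that[of N]) (auto simp: negligible_iff_null_sets)
qed

lemma AE_lebesgue_on_negligible:
  assumes "negligible N" "\<And>t. t \<in> {a..b::real} - N \<Longrightarrow> P t"
  shows "AE t in lebesgue_on {a..b}. P t"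
proof (subst AE_restrict_space_iff)
  show "AE t in lebesgue. t \<in> {a..b} \<longrightarrow> P t"
    using assms by (intro AE_I'[of N]) (auto simp: negligible_iff_null_sets)
qed auto

text \<open>Off the null set \<open>N\<close> the increments are locally of order \<open>\<epsilon> (s - r)\<close>; the intervals needed around
  points of \<open>N\<close> lie in an open set of small measure, where absolute continuity applies.\<close>

lemma subadditive_interval_function_nonpos:
  fixes \<mu> :: "real \<Rightarrow> real \<Rightarrow> real"
  assumes "a \<le> b"
    and sub: "\<And>r s t. a \<le> r \<Longrightarrow> r \<le> s \<Longrightarrow> s \<le> t \<Longrightarrow> t \<le> b \<Longrightarrow> \<mu> r t \<le> \<mu> r s + \<mu> s t"
    and refl: "\<And>t. \<mu> t t = 0"
    and ac: "\<And>\<epsilon>. \<epsilon> > 0 \<Longrightarrow> \<exists>\<delta>>0. \<forall>(n::nat) s t.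
      (\<forall>i<n. a \<le> s i \<and> s i \<le> t i \<and> t i \<le> b) \<and> disjoint_family_on (\<lambda>i. {s i<..<t i}) {..<n} \<and>
      (\<Sum>i<n. t i - s i) < \<delta> \<longrightarrow> (\<Sum>i<n. \<mu> (s i) (t i)) \<le> \<epsilon>"
    and N: "negligible N"
    and loc: "\<And>t \<epsilon>. t \<in> {a..b} - N \<Longrightarrow> \<epsilon> > 0 \<Longrightarrow>
      \<exists>d>0. \<forall>r s. a \<le> r \<longrightarrow> r \<le> t \<longrightarrow> t \<le> s \<longrightarrow> s \<le> b \<longrightarrow> s - r < d \<longrightarrow> \<mu> r s \<le> \<epsilon> * (s - r)"
  shows "\<mu> a b \<le> 0"
proof (rule field_le_epsilon)
  fix e :: real assume "e > 0"
  define \<epsilon> where "\<epsilon> = e / (b - a + 1)"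
  have \<epsilon>: "\<epsilon> > 0" "\<epsilon> * (b - a) + \<epsilon> = e" using \<open>e > 0\<close> \<open>a \<le> b\<close>
    by (simp_all add: \<epsilon>_def divide_simps) (simp add: algebra_simps)
  obtain \<delta> where \<delta>: "\<delta> > 0" "\<And>(n::nat) s t. (\<And>i. i < n \<Longrightarrow> a \<le> s i \<and> s i \<le> t i \<and> t i \<le> b) \<Longrightarrow>
      disjoint_family_on (\<lambda>i. {s i<..<t i}) {..<n} \<Longrightarrow> (\<Sum>i<n. t i - s i) < \<delta> \<Longrightarrow> (\<Sum>i<n. \<mu> (s i) (t i)) \<le> \<epsilon>"
    using ac[OF \<epsilon>(1)] by blast
  have "N \<in> null_sets lebesgue" using N by (simp add: negligible_iff_null_sets)
  then obtain U where U: "open U" "N \<subseteq> U" "emeasure lebesgue (U - N) < ennreal \<delta>"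
    using sets_lebesgue_outer_open[of N \<delta>] \<delta>(1) by (metis null_setsD2)
  have "emeasure lebesgue (U - N) = emeasure lebesgue U"
    using \<open>N \<in> null_sets lebesgue\<close> U(1) by (intro emeasure_Diff_null_set) auto
  then have Um: "emeasure lborel U < ennreal \<delta>" using U by simp
  \<comment> \<open>\<open>D\<close> lists the intervals around points of the null set, where no
    local estimate is available. They are open and lie in \<open>U\<close>, so lists of adjacent
    intervals can be united and their total length stays below \<delta>.\<close>
  define Q where "Q r s D \<longleftrightarrow> finite D \<and> (\<forall>(p, q)\<in>D. r \<le> p \<and> p < q \<and> q \<le> s \<and> {p<..<q} \<subseteq> U) \<and>
      disjoint_family_on (\<lambda>(p, q). {p<..<q}) D \<and> \<mu> r s \<le> \<epsilon> * (s - r) + (\<Sum>(p, q)\<in>D. \<mu> p q)" for r s D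
  define P where "P r s \<longleftrightarrow> (a \<le> r \<longrightarrow> s \<le> b \<longrightarrow> (\<exists>D. Q r s D))" for r s
  have "P a b"
    using \<open>a \<le> b\<close>
  proof (induction rule: Bolzano)
    case (trans r m s)
    show ?case
      unfolding P_def
    proof (intro impI)
      assume "a \<le> r" "s \<le> b"
      then obtain D1 D2 where D: "Q r m D1" "Q m s D2" using trans unfolding P_def by fastforce
      then have ord: "\<And>p q. (p, q) \<in> D1 \<Longrightarrow> r \<le> p \<and> p < q \<and> q \<le> m \<and> {p<..<q} \<subseteq> U"
        "\<And>p q. (p, q) \<in> D2 \<Longrightarrow> m \<le> p \<and> p < q \<and> q \<le> s \<and> {p<..<q} \<subseteq> U"
        and fin: "finite D1" "finite D2"
        unfolding Q_def by blast+
      \<comment> \<open>The strict \<open>p < q\<close> in \<open>Q\<close> matters here: a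
        degenerate pair \<open>(m, m)\<close> could occur in both lists.\<close>
      have dis: "D1 \<inter> D2 = {}" using ord by force
      have "disjoint_family_on (\<lambda>(p, q). {p<..<q}) (D1 \<union> D2)"
        unfolding disjoint_family_on_def
      proof (intro ballI impI)
        fix i j assume ij: "i \<in> D1 \<union> D2" "j \<in> D1 \<union> D2" "i \<noteq> j"
        obtain p q p' q' where [simp]: "i = (p, q)" "j = (p', q')" by fastforce
        consider "i \<in> D1 \<and> j \<in> D1 \<or> i \<in> D2 \<and> j \<in> D2" | "i \<in> D1" "j \<in> D2" | "i \<in> D2" "j \<in> D1"
          using ij by blast
        then show "(case i of (p, q) \<Rightarrow> {p<..<q}) \<inter> (case j of (p, q) \<Rightarrow> {p<..<q}) = {}"
        proof cases
          case 1
          then show ?thesis using D ij(3) unfolding Q_def disjoint_family_on_def by blast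
        next
          case 2
          then show ?thesis using ord(1)[of p q] ord(2)[of p' q'] by auto
        next
          case 3
          then show ?thesis using ord(2)[of p q] ord(1)[of p' q'] by auto
        qed
      qed
      moreover have "\<mu> r s \<le> \<epsilon> * (s - r) + (\<Sum>(p, q)\<in>D1 \<union> D2. \<mu> p q)"
      proof -
        have "\<mu> r s \<le> \<mu> r m + \<mu> m s" using trans \<open>a \<le> r\<close> \<open>s \<le> b\<close> by (intro sub)
        also have "\<dots> \<le> (\<epsilon> * (m - r) + (\<Sum>(p, q)\<in>D1. \<mu> p q)) + (\<epsilon> * (s - m) + (\<Sum>(p, q)\<in>D2. \<mu> p q))"
          using D unfolding Q_def by (intro add_mono) blast+
        also have "\<dots> = \<epsilon> * (s - r) + (\<Sum>(p, q)\<in>D1 \<union> D2. \<mu> p q)"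
          using fin dis by (simp add: sum.union_disjoint algebra_simps)
        finally show ?thesis .
      qed
      moreover have "\<forall>(p, q)\<in>D1 \<union> D2. r \<le> p \<and> p < q \<and> q \<le> s \<and> {p<..<q} \<subseteq> U"
        using ord trans by fastforce
      ultimately have "Q r s (D1 \<union> D2)" using fin unfolding Q_def by blast
      then show "\<exists>D. Q r s D" by blast
    qed
  next
    case (local t)
    show ?case
    proof (cases "t \<in> N")
      case False
      then obtain d where d: "d > 0" "\<And>r s. a \<le> r \<Longrightarrow> r \<le> t \<Longrightarrow> t \<le> s \<Longrightarrow> s \<le> b \<Longrightarrow> s - r < d \<Longrightarrow> \<mu> r s \<le> \<epsilon> * (s - r)"
        using loc[of t \<epsilon>] local \<epsilon>(1) by auto
      have "Q r s {}" if "a \<le> r" "r \<le> t" "t \<le> s" "s \<le> b" "s - r < d" for r s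
        using d(2)[OF that] by (simp add: Q_def disjoint_family_on_def)
      then show ?thesis using d(1) unfolding P_def by blast
    next
      case True
      then obtain d where d: "d > 0" "ball t d \<subseteq> U" using U openE by blast
      have "\<exists>D. Q r s D" if rs: "r \<le> t" "t \<le> s" "s - r < d" for r s
      proof (cases "r < s")
        case True
        have "{r<..<s} \<subseteq> ball t d" using rs by (auto simp: dist_real_def)
        then have "Q r s {(r, s)}" using True d(2) \<epsilon>(1) by (auto simp: Q_def disjoint_family_on_def)
        then show ?thesis by blast
      next
        case False
        then have "r = s" using rs by simp
        then have "Q r s {}" using refl[of s] by (simp add: Q_def disjoint_family_on_def)
        then show ?thesis by blast
      qed
      then show ?thesis using d(1) unfolding P_def by blast
    qed
  qed
  then obtain D where D: "Q a b D" unfolding P_def by blast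
  then have fin: "finite D" and ord: "\<And>i. i \<in> D \<Longrightarrow> a \<le> fst i \<and> fst i < snd i \<and> snd i \<le> b \<and> {fst i<..<snd i} \<subseteq> U"
    and disj: "disjoint_family_on (\<lambda>i. {fst i<..<snd i}) D"
    and le: "\<mu> a b \<le> \<epsilon> * (b - a) + (\<Sum>i\<in>D. \<mu> (fst i) (snd i))"
    unfolding Q_def by (auto simp: case_prod_unfold)
  obtain h where h: "bij_betw h {0..<card D} D" using ex_bij_betw_nat_finite[OF fin] by blast
  then have h: "bij_betw h {..<card D} D" by (simp add: atLeast0LessThan)
  have hD: "h i \<in> D" if "i < card D" for i using h that by (auto simp: bij_betw_def)
  have "(\<Sum>i\<in>D. ennreal (snd i - fst i)) = (\<Sum>i\<in>D. emeasure lborel {fst i<..<snd i})"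
    using ord by (intro sum.cong) (auto simp: less_imp_le)
  also have "\<dots> = emeasure lborel (\<Union>i\<in>D. {fst i<..<snd i})"
    using disj fin by (intro sum_emeasure) auto
  also have "\<dots> \<le> emeasure lborel U" using ord U(1) by (intro emeasure_mono) auto
  also have "\<dots> < ennreal \<delta>" by (rule Um)
  finally have "ennreal (\<Sum>i\<in>D. snd i - fst i) < ennreal \<delta>"
    using ord by (subst sum_ennreal[symmetric]) (auto simp: less_imp_le)
  moreover have "0 \<le> (\<Sum>i\<in>D. snd i - fst i)" using ord by (intro sum_nonneg) (auto simp: less_imp_le)
  ultimately have small: "(\<Sum>i\<in>D. snd i - fst i) < \<delta>" by (simp add: ennreal_less_iff)
  have "(\<Sum>i<card D. \<mu> (fst (h i)) (snd (h i))) \<le> \<epsilon>"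
  proof (rule \<delta>(2))
    show "a \<le> fst (h i) \<and> fst (h i) \<le> snd (h i) \<and> snd (h i) \<le> b" if "i < card D" for i
      using ord[OF hD[OF that]] by auto
    show "disjoint_family_on (\<lambda>i. {fst (h i)<..<snd (h i)}) {..<card D}"
      using disj h unfolding disjoint_family_on_def bij_betw_def inj_on_def by blast
    show "(\<Sum>i<card D. snd (h i) - fst (h i)) < \<delta>"
      using small by (subst sum.reindex_bij_betw[OF h, of "\<lambda>i. snd i - fst i"])
  qed
  then have "(\<Sum>i\<in>D. \<mu> (fst i) (snd i)) \<le> \<epsilon>"
    by (subst (asm) sum.reindex_bij_betw[OF h, of "\<lambda>i. \<mu> (fst i) (snd i)"])
  then show "\<mu> a b \<le> 0 + e" using le \<epsilon>(2) by linarith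
qed

lemma absolutely_continuous_function_onD:
  assumes "absolutely_continuous_function_on a b f" "\<epsilon> > 0"
  obtains \<delta> where "\<delta> > 0" "\<And>(n::nat) s t. (\<And>i. i < n \<Longrightarrow> a \<le> s i \<and> s i \<le> t i \<and> t i \<le> b) \<Longrightarrow>
      disjoint_family_on (\<lambda>i. {s i<..<t i}) {..<n} \<Longrightarrow> (\<Sum>i<n. t i - s i) < \<delta> \<Longrightarrow>
      (\<Sum>i<n. norm (f (t i) - f (s i))) < \<epsilon>"
proof -
  obtain \<delta> where "\<delta> > 0" "\<forall>(n::nat) s t. (\<forall>i<n. a \<le> s i \<and> s i \<le> t i \<and> t i \<le> b) \<and>
      disjoint_family_on (\<lambda>i. {s i<..<t i}) {..<n} \<and> (\<Sum>i<n. t i - s i) < \<delta> \<longrightarrow>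
      (\<Sum>i<n. norm (f (t i) - f (s i))) < \<epsilon>"
    using assms unfolding absolutely_continuous_function_on_def by blast
  then show ?thesis by (intro that[of \<delta>]) simp_all
qed

lemma absolutely_continuous_function_on_subset:
  assumes "absolutely_continuous_function_on a b f" "a \<le> c" "d \<le> b"
  shows "absolutely_continuous_function_on c d f"
  unfolding absolutely_continuous_function_on_def
proof (intro allI impI)
  fix \<epsilon> :: real assume "\<epsilon> > 0"
  obtain \<delta> where \<delta>: "\<delta> > 0" "\<And>(n::nat) s t. (\<And>i. i < n \<Longrightarrow> a \<le> s i \<and> s i \<le> t i \<and> t i \<le> b) \<Longrightarrow>
      disjoint_family_on (\<lambda>i. {s i<..<t i}) {..<n} \<Longrightarrow> (\<Sum>i<n. t i - s i) < \<delta> \<Longrightarrow>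
      (\<Sum>i<n. norm (f (t i) - f (s i))) < \<epsilon>"
    using absolutely_continuous_function_onD[OF assms(1) \<open>\<epsilon> > 0\<close>] by blast
  show "\<exists>\<delta>>0. \<forall>(n::nat) s t. (\<forall>i<n. c \<le> s i \<and> s i \<le> t i \<and> t i \<le> d) \<and>
      disjoint_family_on (\<lambda>i. {s i<..<t i}) {..<n} \<and> (\<Sum>i<n. t i - s i) < \<delta> \<longrightarrow>
      (\<Sum>i<n. norm (f (t i) - f (s i))) < \<epsilon>"
  proof (intro exI[of _ \<delta>] conjI allI impI)
    fix n :: nat and s t
    assume *: "(\<forall>i<n. c \<le> s i \<and> s i \<le> t i \<and> t i \<le> d) \<and>
      disjoint_family_on (\<lambda>i. {s i<..<t i}) {..<n} \<and> (\<Sum>i<n. t i - s i) < \<delta>"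
    show "(\<Sum>i<n. norm (f (t i) - f (s i))) < \<epsilon>"
      by (rule \<delta>(2)) (use * assms(2,3) in \<open>auto intro: order.trans\<close>)
  qed (rule \<delta>(1))
qed

text \<open>One comparison that covers constants, sign changes, differences, squares and the
  composition of a Lipschitz curve with the time change.\<close>

lemma absolutely_continuous_function_on_dominated:
  fixes f :: "real \<Rightarrow> 'a::real_normed_vector" and g :: "real \<Rightarrow> 'b::real_normed_vector"
    and h :: "real \<Rightarrow> 'c::real_normed_vector"
  assumes g: "absolutely_continuous_function_on a b g" and h: "absolutely_continuous_function_on a b h"
    and le: "\<And>r s. a \<le> r \<Longrightarrow> r \<le> s \<Longrightarrow> s \<le> b \<Longrightarrow> norm (f s - f r) \<le> c * (norm (g s - g r) + norm (h s - h r))"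
  shows "absolutely_continuous_function_on a b f"
  unfolding absolutely_continuous_function_on_def
proof (intro allI impI)
  fix \<epsilon> :: real assume "\<epsilon> > 0"
  define e where "e = \<epsilon> / (2 * (\<bar>c\<bar> + 1))"
  have e: "e > 0" "(\<bar>c\<bar> + 1) * (e + e) = \<epsilon>"
  proof -
    have "2 * (\<bar>c\<bar> + 1) > 0" by simp
    then show "e > 0" "(\<bar>c\<bar> + 1) * (e + e) = \<epsilon>" using \<open>\<epsilon> > 0\<close> by (simp_all add: e_def divide_simps)
  qed
  obtain \<delta>1 where \<delta>1: "\<delta>1 > 0" "\<And>(n::nat) s t. (\<And>i. i < n \<Longrightarrow> a \<le> s i \<and> s i \<le> t i \<and> t i \<le> b) \<Longrightarrow>
      disjoint_family_on (\<lambda>i. {s i<..<t i}) {..<n} \<Longrightarrow> (\<Sum>i<n. t i - s i) < \<delta>1 \<Longrightarrow>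
      (\<Sum>i<n. norm (g (t i) - g (s i))) < e"
    using absolutely_continuous_function_onD[OF g e(1)] by blast
  obtain \<delta>2 where \<delta>2: "\<delta>2 > 0" "\<And>(n::nat) s t. (\<And>i. i < n \<Longrightarrow> a \<le> s i \<and> s i \<le> t i \<and> t i \<le> b) \<Longrightarrow>
      disjoint_family_on (\<lambda>i. {s i<..<t i}) {..<n} \<Longrightarrow> (\<Sum>i<n. t i - s i) < \<delta>2 \<Longrightarrow>
      (\<Sum>i<n. norm (h (t i) - h (s i))) < e"
    using absolutely_continuous_function_onD[OF h e(1)] by blast
  show "\<exists>\<delta>>0. \<forall>(n::nat) s t. (\<forall>i<n. a \<le> s i \<and> s i \<le> t i \<and> t i \<le> b) \<and>
      disjoint_family_on (\<lambda>i. {s i<..<t i}) {..<n} \<and> (\<Sum>i<n. t i - s i) < \<delta> \<longrightarrow>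
      (\<Sum>i<n. norm (f (t i) - f (s i))) < \<epsilon>"
  proof (intro exI[of _ "min \<delta>1 \<delta>2"] conjI allI impI)
    fix n :: nat and s t
    assume *: "(\<forall>i<n. a \<le> s i \<and> s i \<le> t i \<and> t i \<le> b) \<and>
      disjoint_family_on (\<lambda>i. {s i<..<t i}) {..<n} \<and> (\<Sum>i<n. t i - s i) < min \<delta>1 \<delta>2"
    let ?G = "\<Sum>i<n. norm (g (t i) - g (s i))" and ?H = "\<Sum>i<n. norm (h (t i) - h (s i))"
    have "?G < e" "?H < e" using \<delta>1(2)[of n s t] \<delta>2(2)[of n s t] * by auto
    have "(\<Sum>i<n. norm (f (t i) - f (s i))) \<le> (\<Sum>i<n. (\<bar>c\<bar> + 1) * (norm (g (t i) - g (s i)) + norm (h (t i) - h (s i))))"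
    proof (rule sum_mono)
      fix i assume "i \<in> {..<n}"
      then have "norm (f (t i) - f (s i)) \<le> c * (norm (g (t i) - g (s i)) + norm (h (t i) - h (s i)))"
        using * by (intro le) auto
      also have "\<dots> \<le> (\<bar>c\<bar> + 1) * (norm (g (t i) - g (s i)) + norm (h (t i) - h (s i)))"
        by (intro mult_right_mono) auto
      finally show "norm (f (t i) - f (s i)) \<le> (\<bar>c\<bar> + 1) * (norm (g (t i) - g (s i)) + norm (h (t i) - h (s i)))" .
    qed
    also have "\<dots> = (\<bar>c\<bar> + 1) * (?G + ?H)"
      by (simp add: sum_distrib_left sum.distrib distrib_left)
    also have "\<dots> < (\<bar>c\<bar> + 1) * (e + e)"
      using \<open>?G < e\<close> \<open>?H < e\<close> by (intro mult_strict_left_mono) auto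
    finally show "(\<Sum>i<n. norm (f (t i) - f (s i))) < \<epsilon>" by (simp only: e(2))
  qed (use \<delta>1 \<delta>2 in auto)
qed

lemma absolutely_continuous_function_on_imp_continuous:
  assumes f: "absolutely_continuous_function_on a b f"
  shows "continuous_on {a..b} f"
  unfolding continuous_on_iff
proof (intro ballI allI impI)
  fix x and e :: real assume x: "x \<in> {a..b}" and "e > 0"
  obtain \<delta> where \<delta>: "\<delta> > 0" "\<And>(n::nat) s t. (\<And>i. i < n \<Longrightarrow> a \<le> s i \<and> s i \<le> t i \<and> t i \<le> b) \<Longrightarrow>
      disjoint_family_on (\<lambda>i. {s i<..<t i}) {..<n} \<Longrightarrow> (\<Sum>i<n. t i - s i) < \<delta> \<Longrightarrow>
      (\<Sum>i<n. norm (f (t i) - f (s i))) < e"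
    using absolutely_continuous_function_onD[OF f \<open>e > 0\<close>] by blast
  show "\<exists>d>0. \<forall>x'\<in>{a..b}. dist x' x < d \<longrightarrow> dist (f x') (f x) < e"
  proof (intro exI[of _ \<delta>] conjI ballI impI)
    fix y assume "y \<in> {a..b}" "dist y x < \<delta>"
    then have "norm (f (max x y) - f (min x y)) < e"
      using \<delta>(2)[of 1 "\<lambda>_. min x y" "\<lambda>_. max x y"] x
      by (auto simp: disjoint_family_on_def dist_real_def min_def max_def split: if_splits)
    then show "dist (f y) (f x) < e"
      by (auto simp: dist_norm min_def max_def norm_minus_commute split: if_splits)
  qed (rule \<delta>(1))
qed

text \<open>A mean value inequality for almost everywhere derivatives. The defect \<mu> is
  subadditive by the triangle inequality, and at a point where both derivatives exist and are
  ordered it is at most \<epsilon> times the length of a short surrounding interval. No integral of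
  \<open>F'\<close> enters, so \<open>F\<close> may take values in any normed space.\<close>

lemma absolutely_continuous_increment_le:
  fixes F :: "real \<Rightarrow> 'a::real_normed_vector" and G :: "real \<Rightarrow> real"
  assumes "a \<le> b"
    and F: "absolutely_continuous_function_on a b F" and G: "absolutely_continuous_function_on a b G"
    and N: "negligible N"
    and F': "\<And>t. t \<in> {a..b} - N \<Longrightarrow> (F has_vector_derivative F' t) (at t within {a..b})"
    and G': "\<And>t. t \<in> {a..b} - N \<Longrightarrow> (G has_vector_derivative G' t) (at t within {a..b})"
    and le: "\<And>t. t \<in> {a..b} - N \<Longrightarrow> norm (F' t) \<le> G' t"
  shows "norm (F b - F a) \<le> G b - G a"
proof -
  define \<mu> where "\<mu> r s = norm (F s - F r) - (G s - G r)" for r s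
  have "\<mu> a b \<le> 0"
  proof (rule subadditive_interval_function_nonpos[OF \<open>a \<le> b\<close> _ _ _ N])
    show "\<mu> r t \<le> \<mu> r s + \<mu> s t" for r s t
      using norm_triangle_ineq[of "F t - F s" "F s - F r"] by (simp add: \<mu>_def)
    show "\<mu> t t = 0" for t by (simp add: \<mu>_def)
  next
    fix \<epsilon> :: real assume "\<epsilon> > 0"
    then have "\<epsilon> / 2 > 0" by simp
    obtain \<delta>1 where \<delta>1: "\<delta>1 > 0" "\<And>(n::nat) s t. (\<And>i. i < n \<Longrightarrow> a \<le> s i \<and> s i \<le> t i \<and> t i \<le> b) \<Longrightarrow>
        disjoint_family_on (\<lambda>i. {s i<..<t i}) {..<n} \<Longrightarrow> (\<Sum>i<n. t i - s i) < \<delta>1 \<Longrightarrow>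
        (\<Sum>i<n. norm (F (t i) - F (s i))) < \<epsilon> / 2"
      using absolutely_continuous_function_onD[OF F \<open>\<epsilon> / 2 > 0\<close>] by blast
    obtain \<delta>2 where \<delta>2: "\<delta>2 > 0" "\<And>(n::nat) s t. (\<And>i. i < n \<Longrightarrow> a \<le> s i \<and> s i \<le> t i \<and> t i \<le> b) \<Longrightarrow>
        disjoint_family_on (\<lambda>i. {s i<..<t i}) {..<n} \<Longrightarrow> (\<Sum>i<n. t i - s i) < \<delta>2 \<Longrightarrow>
        (\<Sum>i<n. norm (G (t i) - G (s i))) < \<epsilon> / 2"
      using absolutely_continuous_function_onD[OF G \<open>\<epsilon> / 2 > 0\<close>] by blast
    show "\<exists>\<delta>>0. \<forall>(n::nat) s t. (\<forall>i<n. a \<le> s i \<and> s i \<le> t i \<and> t i \<le> b) \<and>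
        disjoint_family_on (\<lambda>i. {s i<..<t i}) {..<n} \<and> (\<Sum>i<n. t i - s i) < \<delta> \<longrightarrow> (\<Sum>i<n. \<mu> (s i) (t i)) \<le> \<epsilon>"
    proof (intro exI[of _ "min \<delta>1 \<delta>2"] conjI allI impI)
      fix n :: nat and s t
      assume *: "(\<forall>i<n. a \<le> s i \<and> s i \<le> t i \<and> t i \<le> b) \<and>
        disjoint_family_on (\<lambda>i. {s i<..<t i}) {..<n} \<and> (\<Sum>i<n. t i - s i) < min \<delta>1 \<delta>2"
      have "(\<Sum>i<n. \<mu> (s i) (t i)) \<le> (\<Sum>i<n. norm (F (t i) - F (s i)) + norm (G (t i) - G (s i)))"
        by (intro sum_mono) (simp add: \<mu>_def)
      then show "(\<Sum>i<n. \<mu> (s i) (t i)) \<le> \<epsilon>"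
        using \<delta>1(2)[of n s t] \<delta>2(2)[of n s t] * by (simp add: sum.distrib)
    qed (use \<delta>1 \<delta>2 in auto)
  next
    fix t \<epsilon> :: real assume t: "t \<in> {a..b} - N" and "\<epsilon> > 0"
    then have "\<epsilon> / 2 > 0" by simp
    obtain d1 where d1: "d1 > 0" "\<And>y. y \<in> {a..b} \<Longrightarrow> norm (y - t) < d1 \<Longrightarrow> norm (F y - F t - (y - t) *\<^sub>R F' t) \<le> \<epsilon> / 2 * norm (y - t)"
      using F'[OF t] \<open>\<epsilon> / 2 > 0\<close> unfolding has_vector_derivative_def has_derivative_within_alt by meson
    obtain d2 where d2: "d2 > 0" "\<And>y. y \<in> {a..b} \<Longrightarrow> norm (y - t) < d2 \<Longrightarrow> norm (G y - G t - (y - t) *\<^sub>R G' t) \<le> \<epsilon> / 2 * norm (y - t)"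
      using G'[OF t] \<open>\<epsilon> / 2 > 0\<close> unfolding has_vector_derivative_def has_derivative_within_alt by meson
    show "\<exists>d>0. \<forall>r s. a \<le> r \<longrightarrow> r \<le> t \<longrightarrow> t \<le> s \<longrightarrow> s \<le> b \<longrightarrow> s - r < d \<longrightarrow> \<mu> r s \<le> \<epsilon> * (s - r)"
    proof (intro exI[of _ "min d1 d2"] conjI allI impI)
      fix r s assume rs: "a \<le> r" "r \<le> t" "t \<le> s" "s \<le> b" "s - r < min d1 d2"
      have F1: "norm (F y - F t) \<le> \<bar>y - t\<bar> * norm (F' t) + \<epsilon> / 2 * \<bar>y - t\<bar>" if "y = r \<or> y = s" for y
      proof -
        have "norm (F y - F t - (y - t) *\<^sub>R F' t) \<le> \<epsilon> / 2 * norm (y - t)"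
          using that rs by (intro d1) auto
        then show ?thesis
          using norm_triangle_ineq[of "F y - F t - (y - t) *\<^sub>R F' t" "(y - t) *\<^sub>R F' t"] by simp
      qed
      have "norm (F s - F r) \<le> norm (F s - F t) + norm (F r - F t)"
        using norm_triangle_ineq4[of "F s - F t" "F r - F t"] by simp
      also have "\<dots> \<le> (s - r) * norm (F' t) + \<epsilon> / 2 * (s - r)"
      proof -
        have "norm (F s - F t) \<le> (s - t) * norm (F' t) + \<epsilon> / 2 * (s - t)" using F1[of s] rs by simp
        moreover have "norm (F r - F t) \<le> (t - r) * norm (F' t) + \<epsilon> / 2 * (t - r)" using F1[of r] rs by simp
        moreover have "(s - r) * norm (F' t) + \<epsilon> / 2 * (s - r) =
            ((s - t) * norm (F' t) + \<epsilon> / 2 * (s - t)) + ((t - r) * norm (F' t) + \<epsilon> / 2 * (t - r))"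
          by (simp add: algebra_simps diff_divide_distrib)
        ultimately show ?thesis by linarith
      qed
      also have "\<dots> \<le> (s - r) * G' t + \<epsilon> / 2 * (s - r)"
        using le[OF t] rs by (intro add_right_mono mult_left_mono) auto
      finally have 1: "norm (F s - F r) \<le> (s - r) * G' t + \<epsilon> / 2 * (s - r)" .
      have "\<bar>G s - G t - (s - t) * G' t\<bar> \<le> \<epsilon> / 2 * (s - t)" "\<bar>G r - G t - (r - t) * G' t\<bar> \<le> \<epsilon> / 2 * (t - r)"
        using d2(2)[of s] d2(2)[of r] rs by auto
      then have "(G s - G t - (s - t) * G' t) - (G r - G t - (r - t) * G' t) \<ge> - (\<epsilon> / 2 * (s - t)) - \<epsilon> / 2 * (t - r)"
        unfolding abs_le_iff by linarith
      then have "G s - G r \<ge> (s - r) * G' t - \<epsilon> / 2 * (s - r)"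
        by (simp add: algebra_simps diff_divide_distrib)
      moreover have "\<epsilon> / 2 * (s - r) + \<epsilon> / 2 * (s - r) = \<epsilon> * (s - r)" by (simp flip: distrib_right)
      ultimately show "\<mu> r s \<le> \<epsilon> * (s - r)" using 1 unfolding \<mu>_def by linarith
    qed (use d1 d2 in auto)
  qed
  then show ?thesis by (simp add: \<mu>_def)
qed

lemma absolutely_continuous_antimono:
  fixes f :: "real \<Rightarrow> real"
  assumes "a \<le> b" "absolutely_continuous_function_on a b f" "negligible N"
    and "\<And>t. t \<in> {a..b} - N \<Longrightarrow> (f has_vector_derivative f' t) (at t within {a..b})"
    and "\<And>t. t \<in> {a..b} - N \<Longrightarrow> f' t \<le> 0"
  shows "f b \<le> f a"
proof -
  have "norm ((0::real) - 0) \<le> (- f b) - (- f a)"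
  proof (rule absolutely_continuous_increment_le[where F = "\<lambda>_. 0" and F' = "\<lambda>_. 0" and G' = "\<lambda>t. - f' t", OF assms(1) _ _ assms(3)])
    show "absolutely_continuous_function_on a b (\<lambda>_. 0::real)"
      by (rule absolutely_continuous_function_on_dominated[OF assms(2,2), of _ 0]) simp
    show "absolutely_continuous_function_on a b (\<lambda>t. - f t)"
      by (rule absolutely_continuous_function_on_dominated[OF assms(2,2), of _ 1]) (simp add: abs_minus_commute)
  qed (use assms(4,5) in \<open>auto intro!: derivative_eq_intros\<close>)
  then show ?thesis by simp
qed

text \<open>The sum of increments over disjoint intervals is a single integral over their union,
  which has small measure.\<close>

lemma absolutely_continuous_indefinite_integral:
  fixes v \<phi> :: "real \<Rightarrow> real"
  assumes \<phi>: "integrable lebesgue \<phi>" and pos: "\<And>x. \<phi> x \<ge> 0"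
    and v: "\<And>r s. a \<le> r \<Longrightarrow> r \<le> s \<Longrightarrow> s \<le> b \<Longrightarrow> v s - v r = (LINT x:{r..s}|lebesgue. \<phi> x)"
  shows "absolutely_continuous_function_on a b v"
  unfolding absolutely_continuous_function_on_def
proof (intro allI impI)
  fix \<epsilon> :: real assume "\<epsilon> > 0"
  then obtain \<delta> where \<delta>: "\<delta> > 0"
    "\<And>A. A \<in> sets lebesgue \<Longrightarrow> emeasure lebesgue A < ennreal \<delta> \<Longrightarrow> (LINT x:A|lebesgue. \<phi> x) < \<epsilon>"
    using integral_uniformly_small[OF \<phi> pos] by blast
  show "\<exists>\<delta>>0. \<forall>(n::nat) s t. (\<forall>i<n. a \<le> s i \<and> s i \<le> t i \<and> t i \<le> b) \<and>
      disjoint_family_on (\<lambda>i. {s i<..<t i}) {..<n} \<and> (\<Sum>i<n. t i - s i) < \<delta> \<longrightarrow>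
      (\<Sum>i<n. norm (v (t i) - v (s i))) < \<epsilon>"
  proof (intro exI[of _ \<delta>] conjI allI impI)
    fix n :: nat and s t
    assume *: "(\<forall>i<n. a \<le> s i \<and> s i \<le> t i \<and> t i \<le> b) \<and>
      disjoint_family_on (\<lambda>i. {s i<..<t i}) {..<n} \<and> (\<Sum>i<n. t i - s i) < \<delta>"
    let ?A = "\<Union>i<n. {s i<..<t i}"
    have "(\<Sum>i<n. norm (v (t i) - v (s i))) = (\<Sum>i<n. LINT x:{s i<..<t i}|lebesgue. \<phi> x)"
    proof (rule sum.cong)
      fix i assume "i \<in> {..<n}"
      then have i: "a \<le> s i" "s i \<le> t i" "t i \<le> b" using * by auto
      \<comment> \<open>Only the open intervals are disjoint, so the endpoints are removed before
        the integrals are joined.\<close>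
      have "(LINT x:{s i..t i}|lebesgue. \<phi> x) = (LINT x:{s i<..<t i}|lebesgue. \<phi> x)"
      proof (rule set_integral_null_delta)
        have "{s i..t i} - {s i<..<t i} \<union> ({s i<..<t i} - {s i..t i}) \<subseteq> {s i, t i}" by auto
        then have "negligible ({s i..t i} - {s i<..<t i} \<union> ({s i<..<t i} - {s i..t i}))"
          by (rule negligible_subset[rotated]) simp
        then show "sym_diff {s i..t i} {s i<..<t i} \<in> null_sets lebesgue"
          by (simp add: negligible_iff_null_sets)
      qed (use \<phi> in auto)
      moreover have "0 \<le> (LINT x:{s i..t i}|lebesgue. \<phi> x)"
        unfolding set_lebesgue_integral_def using pos by (intro integral_nonneg_AE AE_I2) simp
      ultimately show "norm (v (t i) - v (s i)) = (LINT x:{s i<..<t i}|lebesgue. \<phi> x)"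
        using v[OF i] by simp
    qed simp
    also have "\<dots> = (LINT x:?A|lebesgue. \<phi> x)"
      using * set_integrable_lebesgue_of_integrable[OF \<phi>]
      by (intro set_integral_finite_Union[symmetric]) auto
    also have "\<dots> < \<epsilon>"
    proof (rule \<delta>(2))
      have "emeasure lebesgue ?A = (\<Sum>i<n. emeasure lebesgue {s i<..<t i})"
        using * by (intro sum_emeasure[symmetric]) auto
      also have "\<dots> = (\<Sum>i<n. ennreal (t i - s i))"
        using * by (intro sum.cong) auto
      also have "\<dots> = ennreal (\<Sum>i<n. t i - s i)" using * by (intro sum_ennreal) auto
      also have "\<dots> < ennreal \<delta>" using * \<delta>(1) by (intro ennreal_lessI) auto
      finally show "emeasure lebesgue ?A < ennreal \<delta>" .
    qed auto
    finally show "(\<Sum>i<n. norm (v (t i) - v (s i))) < \<epsilon>" .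
  qed (rule \<delta>(1))
qed

lemma W11_E:
  assumes "f \<in> W11 T"
  obtains f' N where "absolutely_continuous_function_on 0 T f" "integrable (lebesgue_on {0..T}) f'" "negligible N"
    "\<And>t. t \<in> {0..T} - N \<Longrightarrow> (f has_vector_derivative f' t) (at t within {0..T})"
proof -
  obtain f' where f': "absolutely_continuous_function_on 0 T f" "integrable (lebesgue_on {0..T}) f'"
    "AE t in lebesgue_on {0..T}. (f has_vector_derivative f' t) (at t within {0..T})"
    using assms unfolding W11_def by blast
  then show ?thesis using that AE_lebesgue_on_imp_negligible[OF f'(3)] by metis
qed

section \<open>Uniqueness\<close>

lemma sweeping_solution_unique:
  fixes C :: "real \<Rightarrow> 'a::{real_inner, banach, second_countable_topology} set"
  assumes x: "sweeping_solution T C x0 x" and y: "sweeping_solution T C x0 y" and t0: "t0 \<in> {0..T}"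
  shows "y t0 = x t0"
proof (cases "t0 = 0")
  case True
  then show ?thesis using x y by (simp add: sweeping_solution_def)
next
  case False
  then have "T > 0" using t0 by auto
  obtain x' N1 where x': "absolutely_continuous_function_on 0 T x" "negligible N1"
    "\<And>t. t \<in> {0..T} - N1 \<Longrightarrow> (x has_vector_derivative x' t) (at t within {0..T})"
    using x W11_E[of x T] unfolding sweeping_solution_def by metis
  obtain y' N2 where y': "absolutely_continuous_function_on 0 T y" "negligible N2"
    "\<And>t. t \<in> {0..T} - N2 \<Longrightarrow> (y has_vector_derivative y' t) (at t within {0..T})"
    using y W11_E[of y T] unfolding sweeping_solution_def by metis
  have ae: "AE t in lebesgue_on {0..T}. - vector_derivative x (at t within {0..T}) \<in> normal_cone (C t) (x t)"
    "AE t in lebesgue_on {0..T}. - vector_derivative y (at t within {0..T}) \<in> normal_cone (C t) (y t)"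
    using x y unfolding sweeping_solution_def by blast+
  obtain N3 where N3: "negligible N3" "\<And>t. t \<in> {0..T} - N3 \<Longrightarrow> - vector_derivative x (at t within {0..T}) \<in> normal_cone (C t) (x t)"
    by (rule AE_lebesgue_on_imp_negligible[OF ae(1)]) blast
  obtain N4 where N4: "negligible N4" "\<And>t. t \<in> {0..T} - N4 \<Longrightarrow> - vector_derivative y (at t within {0..T}) \<in> normal_cone (C t) (y t)"
    by (rule AE_lebesgue_on_imp_negligible[OF ae(2)]) blast
  define d where "d t = x t - y t" for t
  define N where "N = N1 \<union> N2 \<union> N3 \<union> N4"
  have N: "negligible N" unfolding N_def by (intro negligible_Un x' y' N3 N4)
  have d_ac: "absolutely_continuous_function_on 0 T d"
  proof (rule absolutely_continuous_function_on_dominated[OF x'(1) y'(1), of _ 1])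
    show "norm (d s - d r) \<le> 1 * (norm (x s - x r) + norm (y s - y r))" for r s
      using norm_triangle_ineq4[of "x s - x r" "y s - y r"] by (simp add: d_def algebra_simps)
  qed
  \<comment> \<open>Squaring is Lipschitz only on bounded sets, so absolute continuity of the
    squared distance needs a bound for \<open>d\<close>.\<close>
  have "compact (d ` {0..T})"
    using absolutely_continuous_function_on_imp_continuous[OF d_ac] by (intro compact_continuous_image) auto
  then obtain M where M: "\<And>t. t \<in> {0..T} \<Longrightarrow> norm (d t) \<le> M"
    using compact_imp_bounded bounded_iff by (metis imageI)
  have sq_ac: "absolutely_continuous_function_on 0 T (\<lambda>t. (norm (d t))\<^sup>2)"
  proof (rule absolutely_continuous_function_on_dominated[OF d_ac d_ac, of _ M])
    fix r s assume rs: "0 \<le> r" "r \<le> s" "s \<le> T"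
    have "norm ((norm (d s))\<^sup>2 - (norm (d r))\<^sup>2) = (norm (d s) + norm (d r)) * \<bar>norm (d s) - norm (d r)\<bar>"
      by (simp add: power2_eq_square square_diff_square_factored abs_mult)
    also have "\<dots> \<le> (M + M) * norm (d s - d r)"
      using M[of s] M[of r] rs norm_triangle_ineq3[of "d s" "d r"]
      by (intro mult_mono add_mono) (auto intro: add_nonneg_nonneg order.trans[OF norm_ge_zero])
    finally show "norm ((norm (d s))\<^sup>2 - (norm (d r))\<^sup>2) \<le> M * (norm (d s - d r) + norm (d s - d r))"
      by (simp add: algebra_simps)
  qed
  have sq': "((\<lambda>t. (norm (d t))\<^sup>2) has_vector_derivative 2 * ((x' t - y' t) \<bullet> d t)) (at t within {0..T})"
    and neg: "2 * ((x' t - y' t) \<bullet> d t) \<le> 0" if t: "t \<in> {0..T} - N" for t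
  proof -
    have xt: "(x has_vector_derivative x' t) (at t within {0..T})" and yt: "(y has_vector_derivative y' t) (at t within {0..T})"
      using t x' y' by (auto simp: N_def)
    have "((\<lambda>t. d t \<bullet> d t) has_derivative (\<lambda>h. d t \<bullet> (h *\<^sub>R (x' t - y' t)) + (h *\<^sub>R (x' t - y' t)) \<bullet> d t)) (at t within {0..T})"
      unfolding d_def using xt yt unfolding has_vector_derivative_def
      by (auto intro!: derivative_eq_intros simp: scaleR_diff_right)
    moreover have "(\<lambda>h. d t \<bullet> (h *\<^sub>R (x' t - y' t)) + (h *\<^sub>R (x' t - y' t)) \<bullet> d t) = (\<lambda>h. h *\<^sub>R (2 * ((x' t - y' t) \<bullet> d t)))"
      by (simp add: fun_eq_iff inner_commute)
    ultimately show "((\<lambda>t. (norm (d t))\<^sup>2) has_vector_derivative 2 * ((x' t - y' t) \<bullet> d t)) (at t within {0..T})"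
      unfolding has_vector_derivative_def power2_norm_eq_inner by simp
    have tT: "t \<in> {0..T}" using t by simp
    have "vector_derivative x (at t within {0..T}) = x' t" "vector_derivative y (at t within {0..T}) = y' t"
      using vector_derivative_within_cbox[OF \<open>T > 0\<close>, of t] tT xt yt by simp_all
    then have "- x' t \<in> normal_cone (C t) (x t)" "- y' t \<in> normal_cone (C t) (y t)"
      using N3(2)[of t] N4(2)[of t] t by (auto simp: N_def)
    \<comment> \<open>By the state constraint each solution is a competitor in the cone inequality
      of the other. Adding the two inequalities is the monotonicity of the normal cone.\<close>
    moreover have "x t \<in> C t" "y t \<in> C t" using x y t by (auto simp: sweeping_solution_def)
    ultimately have "- x' t \<bullet> (y t - x t) \<le> 0" "- y' t \<bullet> (x t - y t) \<le> 0"
      by (auto simp: normal_cone_def)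
    then show "2 * ((x' t - y' t) \<bullet> d t) \<le> 0"
      by (simp add: d_def inner_diff_left inner_diff_right)
  qed
  have sub: "{0..t0} \<subseteq> {0..T}" using t0 by auto
  have "(norm (d t0))\<^sup>2 \<le> (norm (d 0))\<^sup>2"
  proof (rule absolutely_continuous_antimono[where f = "\<lambda>t. (norm (d t))\<^sup>2" and f' = "\<lambda>t. 2 * ((x' t - y' t) \<bullet> d t)", OF _ _ N])
    show "absolutely_continuous_function_on 0 t0 (\<lambda>t. (norm (d t))\<^sup>2)"
      using absolutely_continuous_function_on_subset[OF sq_ac] t0 by auto
    show "((\<lambda>t. (norm (d t))\<^sup>2) has_vector_derivative 2 * ((x' t - y' t) \<bullet> d t)) (at t within {0..t0})"
      if "t \<in> {0..t0} - N" for t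
      using that sub by (intro has_vector_derivative_within_subset[OF sq' sub]) auto
  qed (use t0 neg in auto)
  moreover have "d 0 = 0" using x y by (simp add: d_def sweeping_solution_def)
  ultimately show ?thesis by (simp add: d_def)
qed

subsection \<open>The time change\<close>

text \<open>Why a change of time is harmless: it multiplies the velocity by a nonnegative factor,
  and the inclusion restricts only the direction.\<close>

lemma normal_cone_scaleR:
  assumes "v \<in> normal_cone C x" "c \<ge> 0"
  shows "c *\<^sub>R v \<in> normal_cone C x"
  using assms by (auto simp: normal_cone_def mult_nonneg_nonpos split: if_splits)

lemma sweeping_solution_exists:
  fixes T :: real
    and u :: "real \<Rightarrow> 'a::{real_inner, banach, second_countable_topology} ^ 'm"
    and b :: "real \<Rightarrow> real ^ 'm"
  assumes T: "T > 0" and u: "u \<in> W11 T" and b: "b \<in> W11 T"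
    and slater: "uniform_slater T u b" and x0: "x0 \<in> moving_polyhedron u b 0"
  shows "\<exists>x. sweeping_solution T (moving_polyhedron u b) x0 x"
proof -
  obtain u' Nu where u': "absolutely_continuous_function_on 0 T u" "integrable (lebesgue_on {0..T}) u'" "negligible Nu"
    "\<And>t. t \<in> {0..T} - Nu \<Longrightarrow> (u has_vector_derivative u' t) (at t within {0..T})"
    by (rule W11_E[OF u]) blast
  obtain b' Nb where b': "absolutely_continuous_function_on 0 T b" "integrable (lebesgue_on {0..T}) b'" "negligible Nb"
    "\<And>t. t \<in> {0..T} - Nb \<Longrightarrow> (b has_vector_derivative b' t) (at t within {0..T})"
    by (rule W11_E[OF b]) blast

  define \<phi> where "\<phi> t = indicator {0..T} t *\<^sub>R (norm (u' t) + norm (b' t) + 1)" for t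
  have Icc: "{0..T} \<inter> space lebesgue \<in> sets lebesgue" by simp
  have "integrable (lebesgue_on {0..T}) (\<lambda>t. norm (u' t) + norm (b' t) + 1)"
  proof (intro Bochner_Integration.integrable_add integrable_norm u' b')
    show "integrable (lebesgue_on {0..T}) (\<lambda>t. 1 :: real)"
      by (intro finite_measure.integrable_const finite_measure_lebesgue_on) simp
  qed
  then have \<phi>_on: "integrable (lebesgue_on {0..T}) (\<lambda>t. norm (u' t) + norm (b' t) + 1)" and \<phi>: "integrable lebesgue \<phi>"
    unfolding \<phi>_def by (simp_all add: integrable_restrict_space)
  have \<phi>_pos: "\<phi> t \<ge> 0" for t by (simp add: \<phi>_def)
  have \<phi>_ge: "\<phi> t \<ge> norm (u' t)" "\<phi> t \<ge> norm (b' t)" "\<phi> t \<ge> 1" if "t \<in> {0..T}" for t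
    using that by (simp_all add: \<phi>_def)

  define v where "v t = (LINT x:{0..t}|lebesgue. \<phi> x)" for t
  have v_diff: "v s - v r = (LINT x:{r..s}|lebesgue. \<phi> x)" if rs: "0 \<le> r" "r \<le> s" for r s
  proof -
    have "AE x in lebesgue. \<not> (x \<in> {0..r} \<and> x \<in> {r..s})"
      using AE_completion[OF AE_lborel_singleton[of r]] by eventually_elim auto
    then have "(LINT x:{0..r} \<union> {r..s}|lebesgue. \<phi> x) = v r + (LINT x:{r..s}|lebesgue. \<phi> x)"
      unfolding v_def by (intro set_integral_Un_AE set_integrable_lebesgue_of_integrable[OF \<phi>]) auto
    moreover have "{0..r} \<union> {r..s} = {0..s}" using rs by auto
    ultimately show ?thesis by (simp add: v_def)
  qed
  have v_ac: "absolutely_continuous_function_on 0 T v"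
    using v_diff by (intro absolutely_continuous_indefinite_integral[OF \<phi> \<phi>_pos]) auto
  obtain Nv where Nv: "negligible Nv" "\<And>t. t \<in> {0<..<T} - Nv \<Longrightarrow> (v has_vector_derivative \<phi> t) (at t)"
    using indefinite_integral_has_vector_derivative_ae[OF \<phi>, of 0 T v] v_diff by blast
  have v_lower: "s - r \<le> v s - v r" if rs: "0 \<le> r" "r \<le> s" "s \<le> T" for r s
  proof -
    have "s - r = (LINT x:{r..s}|lebesgue. 1)" using rs by (simp add: set_lebesgue_integral_def)
    also have "\<dots> \<le> (LINT x:{r..s}|lebesgue. \<phi> x)"
    proof (rule set_integral_mono)
      show "set_integrable lebesgue {r..s} (\<lambda>x. 1 :: real)"
        unfolding set_integrable_def using rs by simp
      show "set_integrable lebesgue {r..s} \<phi>" by (rule set_integrable_lebesgue_of_integrable[OF \<phi>]) simp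
    qed (use rs \<phi>_ge in auto)
    finally show ?thesis using v_diff rs by simp
  qed
  have v_upper: "norm (u s - u r) \<le> v s - v r" "norm (b s - b r) \<le> v s - v r"
    if rs: "0 \<le> r" "r \<le> s" "s \<le> T" for r s
  proof -
    \<comment> \<open>The derivative of \<open>v\<close> is known only at interior points of
      \<open>{0..T}\<close>, hence the two endpoints in the exceptional set.\<close>
    define N where "N = Nu \<union> Nb \<union> Nv \<union> {0, T}"
    have N: "negligible N" unfolding N_def by (intro negligible_Un u' b' Nv) simp
    have sub: "{r..s} \<subseteq> {0..T}" using rs by auto
    have v': "(v has_vector_derivative \<phi> t) (at t within {r..s})" if "t \<in> {r..s} - N" for t
      by (rule has_vector_derivative_at_within[OF Nv(2)]) (use that rs in \<open>auto simp: N_def less_le\<close>)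
    have ac: "absolutely_continuous_function_on r s u" "absolutely_continuous_function_on r s b" "absolutely_continuous_function_on r s v"
      using rs by (auto intro: absolutely_continuous_function_on_subset[OF u'(1)]
          absolutely_continuous_function_on_subset[OF b'(1)] absolutely_continuous_function_on_subset[OF v_ac])
    have u't: "(u has_vector_derivative u' t) (at t within {r..s})" "(b has_vector_derivative b' t) (at t within {r..s})"
      if "t \<in> {r..s} - N" for t
      using that sub u'(4)[of t] b'(4)[of t] by (auto simp: N_def intro: has_vector_derivative_within_subset)
    show "norm (u s - u r) \<le> v s - v r"
      using sub by (intro absolutely_continuous_increment_le[OF rs(2) ac(1,3) N u't(1) v'] \<phi>_ge) auto
    show "norm (b s - b r) \<le> v s - v r"
      using sub by (intro absolutely_continuous_increment_le[OF rs(2) ac(2,3) N u't(2) v'] \<phi>_ge) auto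
  qed

  define V where "V = v T"
  have v0: "v 0 = 0"
  proof -
    have "(LINT x:{0..0}|lebesgue. \<phi> x) = (LINT x:{}|lebesgue. \<phi> x)"
      by (rule set_integral_null_delta[OF \<phi>]) (auto simp: negligible_iff_null_sets[symmetric])
    then show ?thesis by (simp add: v_def set_lebesgue_integral_def)
  qed
  have V: "V > 0" using v_lower[of 0 T] v0 T by (simp add: V_def)
  define w where "w t = v t / V" for t
  have w_less: "w r < w s" if "0 \<le> r" "r < s" "s \<le> T" for r s
    using v_lower[of r s] that V by (simp add: w_def divide_strict_right_mono)
  have w_inj: "r = s" if "r \<in> {0..T}" "s \<in> {0..T}" "w r = w s" for r s
    using w_less[of r s] w_less[of s r] that by (cases r s rule: linorder_cases) auto
  have w0: "w 0 = 0" and wT: "w T = 1" using V by (simp_all add: w_def v0 V_def)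
  have w_range: "w t \<in> {0..1}" if "t \<in> {0..T}" for t
    using w_less[of 0 t] w_less[of t T] w0 wT that by (cases "t = 0"; cases "t = T") auto
  have w_cont: "continuous_on {0..T} w"
    unfolding w_def using absolutely_continuous_function_on_imp_continuous[OF v_ac] V
    by (intro continuous_intros) auto
  define cl where "cl p = max 0 (min 1 p)" for p :: real
  have cl: "cl p \<in> {0..1}" "\<bar>cl p - cl q\<bar> \<le> \<bar>p - q\<bar>" for p q by (auto simp: cl_def)
  \<comment> \<open>The inverse of \<open>w\<close>, extended by clamping because
    \<open>lipschitz_sweeping_exists\<close> asks for data at all times. A preimage exists by the
    intermediate value theorem, and it is unique since \<open>w\<close> is strictly
    increasing.\<close>
  define \<sigma> where "\<sigma> p = (SOME t. t \<in> {0..T} \<and> w t = cl p)" for p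
  have \<sigma>: "\<sigma> p \<in> {0..T} \<and> w (\<sigma> p) = cl p" for p
    unfolding \<sigma>_def
  proof (rule someI_ex)
    show "\<exists>t. t \<in> {0..T} \<and> w t = cl p"
      using IVT'[of w 0 "cl p" T] w0 wT cl(1)[of p] w_cont T by auto
  qed
  have \<sigma>_w: "\<sigma> (w t) = t" if "t \<in> {0..T}" for t
    by (rule w_inj) (use w_range[OF that] \<sigma>[of "w t"] that in \<open>auto simp: cl_def\<close>)
  have v_\<sigma>: "\<bar>v (\<sigma> p) - v (\<sigma> q)\<bar> \<le> V * \<bar>p - q\<bar>" for p q
  proof -
    have eq: "v (\<sigma> p) = V * cl p" for p
    proof -
      have "v (\<sigma> p) / V = cl p" using \<sigma>[of p] by (simp add: w_def)
      then show ?thesis using V by (simp add: divide_eq_eq mult.commute)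
    qed
    have "\<bar>v (\<sigma> p) - v (\<sigma> q)\<bar> = V * \<bar>cl p - cl q\<bar>"
      unfolding eq right_diff_distrib[symmetric] abs_mult using V by simp
    also have "\<dots> \<le> V * \<bar>p - q\<bar>" using V cl by (intro mult_left_mono) auto
    finally show ?thesis .
  qed
  have \<sigma>_lipschitz: "\<bar>\<sigma> p - \<sigma> q\<bar> \<le> V * \<bar>p - q\<bar>" for p q
  proof -
    have "\<bar>\<sigma> p - \<sigma> q\<bar> \<le> \<bar>v (\<sigma> p) - v (\<sigma> q)\<bar>"
      using v_lower[of "\<sigma> p" "\<sigma> q"] v_lower[of "\<sigma> q" "\<sigma> p"] \<sigma>[of p] \<sigma>[of q]
      by (cases "\<sigma> p \<le> \<sigma> q") auto
    then show ?thesis using v_\<sigma>[of p q] by linarith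
  qed

  have sym: "norm (f s - f r) \<le> \<bar>v s - v r\<bar>" if "s \<in> {0..T}" "r \<in> {0..T}"
    "\<And>r s. 0 \<le> r \<Longrightarrow> r \<le> s \<Longrightarrow> s \<le> T \<Longrightarrow> norm (f s - f r) \<le> v s - v r"
    for s r and f :: "real \<Rightarrow> 'c::real_normed_vector"
    using that(3)[of r s] that(3)[of s r] that(1,2) by (cases "r \<le> s") (auto simp: norm_minus_commute)
  define uu where "uu p = u (\<sigma> p)" for p
  define bb where "bb p = b (\<sigma> p)" for p
  let ?D = "moving_polyhedron uu bb"
  have D: "?D p = moving_polyhedron u b (\<sigma> p)" for p by (simp add: moving_polyhedron_def uu_def bb_def)
  have "\<exists>X. lipschitz_sweeping ?D 0 1 x0 X"
  proof (rule lipschitz_sweeping_exists)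
    show "norm (uu t - uu s) \<le> V * \<bar>t - s\<bar>" for s t
      unfolding uu_def using \<sigma> v_upper(1) by (intro order.trans[OF sym v_\<sigma>]) auto
    show "norm (bb t - bb s) \<le> V * \<bar>t - s\<bar>" for s t
      unfolding bb_def using \<sigma> v_upper(2) by (intro order.trans[OF sym v_\<sigma>]) auto
    show "\<exists>x. \<forall>i. uu t $ i \<bullet> x < bb t $ i" for t
      using slater \<sigma>[of t] unfolding uniform_slater_def uu_def bb_def by blast
    have "\<sigma> 0 = 0" using \<sigma>_w[of 0] w0 T by simp
    then show "x0 \<in> ?D 0" using x0 by (simp add: D)
  qed (use V in auto)
  then obtain X K where X: "K-lipschitz_on {0..1} X" "X 0 = x0" "\<And>p. p \<in> {0..1} \<Longrightarrow> X p \<in> ?D p"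
    "\<And>p D. 0 \<le> p \<Longrightarrow> p < 1 \<Longrightarrow> (X has_vector_derivative D) (at p within {p..}) \<Longrightarrow> - D \<in> normal_cone (?D p) (X p)"
    unfolding lipschitz_sweeping_def by blast
  obtain g N where g: "g \<in> borel_measurable borel" "\<And>t. norm (g t) \<le> K" "negligible N"
    "\<And>t. t \<in> {0<..<1} - N \<Longrightarrow> (X has_vector_derivative g t) (at t)"
    using lipschitz_curve_ae_differentiable[OF X(1)] by blast

  define x where "x t = X (w t)" for t
  define x' where "x' t = (\<phi> t / V) *\<^sub>R g (w t)" for t
  \<comment> \<open>Exceptional are the times at which \<open>w\<close> may fail to be
    differentiable, those which \<open>w\<close> sends into \<open>N\<close>, and the endpoints. The
    second kind lies in the image of \<open>N\<close> under \<sigma>, null because \<sigma> is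
    Lipschitz.\<close>
  define M where "M = Nv \<union> \<sigma> ` N \<union> {0, T}"
  have "negligible (\<sigma> ` N)"
  proof (rule negligible_locally_Lipschitz_image[OF _ g(3)])
    show "\<exists>S B. open S \<and> p \<in> S \<and> (\<forall>q\<in>N \<inter> S. norm (\<sigma> q - \<sigma> p) \<le> B * norm (q - p))" for p
      using \<sigma>_lipschitz by (intro exI[of _ UNIV] exI[of _ V]) auto
  qed simp
  then have M: "negligible M" unfolding M_def by (intro negligible_Un Nv) auto
  have x_deriv: "(x has_vector_derivative x' t) (at t)" and x_cone: "- x' t \<in> normal_cone (moving_polyhedron u b t) (x t)"
    if t: "t \<in> {0..T} - M" for t
  proof -
    have t': "t \<in> {0<..<T} - Nv" using t by (auto simp: M_def)
    then have "w t \<in> {0<..<1}" using w_less[of 0 t] w_less[of t T] w0 wT by auto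
    moreover have "w t \<notin> N"
    proof
      assume "w t \<in> N"
      then have "\<sigma> (w t) \<in> \<sigma> ` N" by blast
      then show False using \<sigma>_w[of t] t by (auto simp: M_def)
    qed
    ultimately have wt: "w t \<in> {0<..<1} - N" by simp
    have "(w has_vector_derivative \<phi> t / V) (at t)"
      using has_vector_derivative_mult_right[OF Nv(2)[OF t'], of "1 / V"] by (simp add: w_def[abs_def])
    from vector_diff_chain_at[OF this g(4)[OF wt]]
    show "(x has_vector_derivative x' t) (at t)" by (simp add: x_def[abs_def] x'_def comp_def)
    \<comment> \<open>A two-sided derivative is in particular a right derivative, the kind of which
      \<open>lipschitz_sweeping\<close> speaks.\<close>
    have "- g (w t) \<in> normal_cone (?D (w t)) (X (w t))"
      by (rule X(4)[OF _ _ has_vector_derivative_at_within[OF g(4)[OF wt]]]) (use wt in auto)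
    moreover have "?D (w t) = moving_polyhedron u b t" using \<sigma>_w[of t] t by (simp add: D)
    ultimately show "- x' t \<in> normal_cone (moving_polyhedron u b t) (x t)"
      using normal_cone_scaleR[of "- g (w t)" _ _ "\<phi> t / V"] \<phi>_pos V by (simp add: x'_def x_def)
  qed
  have x_ac: "absolutely_continuous_function_on 0 T x"
  proof (rule absolutely_continuous_function_on_dominated[OF v_ac v_ac, of _ "K / V"])
    fix r s assume rs: "0 \<le> r" "r \<le> s" "s \<le> T"
    have "norm (x s - x r) \<le> K * \<bar>w s - w r\<bar>"
      using lipschitz_onD[OF X(1), of "w s" "w r"] w_range rs by (simp add: x_def dist_norm)
    also have "\<dots> = (K / V) * norm (v s - v r)" using V by (simp add: w_def flip: diff_divide_distrib)
    also have "\<dots> \<le> (K / V) * (norm (v s - v r) + norm (v s - v r))"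
      using lipschitz_on_nonneg[OF X(1)] V by (intro mult_left_mono) auto
    finally show "norm (x s - x r) \<le> (K / V) * (norm (v s - v r) + norm (v s - v r))" .
  qed
  have x'_int: "integrable (lebesgue_on {0..T}) x'"
  proof (rule Bochner_Integration.integrable_bound)
    have \<phi>_meas: "\<phi> \<in> borel_measurable (lebesgue_on {0..T})"
      using borel_measurable_integrable[OF \<phi>] by (rule measurable_restrict_space1)
    show "integrable (lebesgue_on {0..T}) (\<lambda>t. (K / V) * (norm (u' t) + norm (b' t) + 1))"
      using \<phi>_on by (rule integrable_mult_right)
    have "w \<in> borel_measurable (lebesgue_on {0..T})"
      using w_cont by (rule continuous_imp_measurable_on_sets_lebesgue) simp
    from measurable_compose[OF this g(1)] have "(\<lambda>t. g (w t)) \<in> borel_measurable (lebesgue_on {0..T})" .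
    then show "x' \<in> borel_measurable (lebesgue_on {0..T})"
      unfolding x'_def using \<phi>_meas by measurable
    show "AE t in lebesgue_on {0..T}. norm (x' t) \<le> norm ((K / V) * (norm (u' t) + norm (b' t) + 1))"
    proof (rule AE_I2)
      fix t assume "t \<in> space (lebesgue_on {0..T})"
      then have "t \<in> {0..T}" by simp
      then have "\<phi> t = norm (u' t) + norm (b' t) + 1" by (simp add: \<phi>_def)
      moreover have "norm (x' t) = (\<phi> t / V) * norm (g (w t))" using \<phi>_pos[of t] V by (simp add: x'_def)
      moreover have "\<dots> \<le> (\<phi> t / V) * K" using \<phi>_pos[of t] V g(2) by (intro mult_left_mono) auto
      ultimately show "norm (x' t) \<le> norm ((K / V) * (norm (u' t) + norm (b' t) + 1))"
        using lipschitz_on_nonneg[OF X(1)] V by (simp add: abs_mult mult.commute)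
    qed
  qed
  have deriv: "(x has_vector_derivative x' t) (at t within {0..T})" if "t \<in> {0..T} - M" for t
    using x_deriv[OF that] by (rule has_vector_derivative_at_within)
  have "sweeping_solution T (moving_polyhedron u b) x0 x"
    unfolding sweeping_solution_def W11_def
  proof (intro conjI CollectI exI[of _ x'] ballI x_ac x'_int)
    show "AE t in lebesgue_on {0..T}. (x has_vector_derivative x' t) (at t within {0..T})"
      using M deriv by (rule AE_lebesgue_on_negligible)
    show "AE t in lebesgue_on {0..T}. - vector_derivative x (at t within {0..T}) \<in> normal_cone (moving_polyhedron u b t) (x t)"
      using M
    proof (rule AE_lebesgue_on_negligible)
      fix t assume t: "t \<in> {0..T} - M"
      then have "vector_derivative x (at t within {0..T}) = x' t"
        using vector_derivative_within_cbox[OF T, of t] deriv[OF t] t by simp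
      then show "- vector_derivative x (at t within {0..T}) \<in> normal_cone (moving_polyhedron u b t) (x t)"
        using x_cone[OF t] by simp
    qed
    show "x 0 = x0" by (simp add: x_def w0 X(2))
    show "x t \<in> moving_polyhedron u b t" if "t \<in> {0..T}" for t
      using X(3)[OF w_range[OF that]] \<sigma>_w[OF that] by (simp add: x_def D)
  qed
  then show ?thesis by blast
qed

theorem theorem3:
  fixes T :: real
    and u :: "real \<Rightarrow> 'a::{real_inner, banach, second_countable_topology} ^ 'm"
    and b :: "real \<Rightarrow> real ^ 'm"
    and x\<^sub>0 :: 'a
  assumes "T > 0"
    and "u \<in> W11 T" and "b \<in> W11 T"
    and "uniform_slater T u b"
    and "x\<^sub>0 \<in> moving_polyhedron u b 0"
  shows "\<exists>x. sweeping_solution T (moving_polyhedron u b) x\<^sub>0 x \<and>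
    (\<forall>y. sweeping_solution T (moving_polyhedron u b) x\<^sub>0 y \<longrightarrow> (\<forall>t\<in>{0..T}. y t = x t))"
  using sweeping_solution_exists[OF assms] sweeping_solution_unique by blast

end
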